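(* Let $f_1,\dots,f_r$ be $r$ distinct functions among the twelve Jacobi elliptic functions (of modulus $k$ attached to a fixed $\tau$ in the complex upper half-plane). For each $\ell=1,\dots,r$ let $\alpha_{\ell,1}<\cdots<\alpha_{\ell,n_\ell}$ and $\alpha'_{\ell,1}<\cdots<\alpha'_{\ell,n'_\ell}$ be positive integers, all of them distinct for fixed $\ell$, and let $\beta_{\ell,1}<\cdots<\beta_{\ell,m_\ell}$ and $\beta'_{\ell,1}<\cdots<\beta'_{\ell,m'_\ell}$ be elements of $\mathbb{Z}^+\cup\{-1\}$. Put $N=\sum_{\ell=1}^r(n_\ell+m_\ell)$ and assume that $$\sum_{p\in\{s,c,d,n\}}\ \max_{\ell:\, f_\ell\in Z_p}\left(4\alpha_{\ell,n_\ell},\,4\alpha'_{\ell,n'_\ell},\,4\beta_{\ell,m_\ell}+4,\,4\beta'_{\ell,m'_\ell}+4\right)=1+N,$$ where $Z_p$ denotes the pole class of the letter $p$, quantities attached to an empty list (e.g. $\alpha_{\ell,n_\ell}$ when $n_\ell=0$) are omitted, and a maximum over an empty set is $0$. Let $\mu_{\ell,j}$ ($1\le j\le n'_\ell$) and $\nu_{\ell,j}$ ($1\le j\le m'_\ell$) be complex numbers, and set $$F(u)=\sum_{\ell=1}^r\sum_{j=1}^{n'_\ell}\mu_{\ell,j}\,f_\ell(u)^{\alpha'_{\ell,j}}+\sum_{\ell=1}^r\sum_{j=1}^{m'_\ell}\nu_{\ell,j}\,f_\ell^{(\beta'_{\ell,j})}(u).$$ Let $g_1,\dots,g_N$ be the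 list of functions obtained by writing, for $\ell=1,\dots,r$ in succession, $f_\ell^{\alpha_{\ell,1}},\dots,f_\ell^{\alpha_{\ell,n_\ell}},f_\ell^{(\beta_{\ell,1})},\dots,f_\ell^{(\beta_{\ell,m_\ell})}$. Let $z_1,\dots,z_N\in\mathbb{C}$ and let $z$ be defined by $z+z_1+\cdots+z_N=0$, where none of $z_1,\dots,z_N,z$ is a pole of any $f_\ell$. Then $$\begin{vmatrix}F(z_1)&g_1(z_1)&\cdots&g_N(z_1)\\ \vdots&\vdots&&\vdots\\ F(z_N)&g_1(z_N)&\cdots&g_N(z_N)\\ F(z)&g_1(z)&\cdots&g_N(z)\end{vmatrix}=0.$$
   Context: Fix $\tau$ in the complex upper half-plane, let $\vartheta_1,\dots,\vartheta_4$ be the Jacobi theta functions $\vartheta_j(u)=\vartheta_j(u,\tau)$ in the Whittaker–Watson convention (nome $q=e^{\pi i\tau}$), with $\vartheta_j=\vartheta_j(0)$. Put $k=\vartheta_2^2/\vartheta_3^2$, $K=\pi\vartheta_3^2/2$, $K'=-i\tau K$. Define $\operatorname{sn}u=\frac{\vartheta_3}{\vartheta_2}\frac{\vartheta_1(\pi u/2K)}{\vartheta_4(\pi u/2K)}$, $\operatorname{cn}u=\frac{\vartheta_4}{\vartheta_2}\frac{\vartheta_2(\pi u/2K)}{\vartheta_4(\pi u/2K)}$, $\operatorname{dn}u=\frac{\vartheta_4}{\vartheta_3}\frac{\vartheta_3(\pi u/2K)}{\vartheta_4(\pi u/2K)}$. With Glaisher's notation, for distinct letters $p,q\in\{s,c,d,n\}$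 set $\operatorname{pq}=\operatorname{pn}/\operatorname{qn}$ with $\operatorname{nn}=1$; this gives the twelve Jacobi elliptic functions sn, cn, dn, ns, cs, ds, nc, sc, dc, nd, sd, cd. All twelve are periodic with respect to $4K$ and $4iK'$. The pole class of a letter $p\in\{s,c,d,n\}$ is $Z_p=\{\operatorname{qp}: q\in\{s,c,d,n\},\ q\ne p\}$ (e.g. $Z_n=\{\operatorname{sn},\operatorname{cn},\operatorname{dn}\}$); its three members share the same poles modulo $(4K,4iK')$. For a Jacobi function $f$, $f^{\alpha}$ denotes the $\alpha$-th power, and $f^{(\beta)}$ the $\beta$-th derivative for $\beta\ge1$, with the convention $f^{(-1)}=1$ (the constant function). *)

theory Defs
  imports "HOL-Complex_Analysis.Complex_Analysis" "Jordan_Normal_Form.Determinant"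
begin

(* Jacobi theta functions in the Whittaker-Watson convention: nome q = exp (pi i tau),
   quasi-periods pi and pi tau in u.  The powers q ^ (n + 1/2)\<^sup>2 are read as
   exp (pi i tau (n + 1/2)\<^sup>2).  Pairing n with -n (resp. -1 - n) turns these bilateral sums
   into the usual cosine (resp. sine) series. *)

definition theta1 :: "complex \<Rightarrow> complex \<Rightarrow> complex" where
  "theta1 \<tau> u = - \<i> * (\<Sum>\<^sub>\<infinity>n::int. (-1) powi n *
     exp (of_real pi * \<i> * \<tau> * (of_int n + 1/2)\<^sup>2 + (2 * of_int n + 1) * \<i> * u))"

definition theta2 :: "complex \<Rightarrow> complex \<Rightarrow> complex" where
  "theta2 \<tau> u = (\<Sum>\<^sub>\<infinity>n::int.
     exp (of_real pi * \<i> * \<tau> * (of_int n + 1/2)\<^sup>2 + (2 * of_int n + 1) * \<i> * u))"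

definition theta3 :: "complex \<Rightarrow> complex \<Rightarrow> complex" where
  "theta3 \<tau> u = (\<Sum>\<^sub>\<infinity>n::int.
     exp (of_real pi * \<i> * \<tau> * (of_int n)\<^sup>2 + 2 * of_int n * \<i> * u))"

definition theta4 :: "complex \<Rightarrow> complex \<Rightarrow> complex" where
  "theta4 \<tau> u = (\<Sum>\<^sub>\<infinity>n::int. (-1) powi n *
     exp (of_real pi * \<i> * \<tau> * (of_int n)\<^sup>2 + 2 * of_int n * \<i> * u))"

definition jacobi_K :: "complex \<Rightarrow> complex" where
  "jacobi_K \<tau> = of_real pi * (theta3 \<tau> 0)\<^sup>2 / 2"

datatype letter = letter_s | letter_c | letter_d | letter_n

(* The functions sn, cn, dn, and nn = 1.  At a pole the value is 0 (division by zero). *)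

fun jacobi_pn :: "complex \<Rightarrow> letter \<Rightarrow> complex \<Rightarrow> complex" where
  "jacobi_pn \<tau> letter_s u = theta3 \<tau> 0 / theta2 \<tau> 0 *
     (theta1 \<tau> (of_real pi * u / (2 * jacobi_K \<tau>)) / theta4 \<tau> (of_real pi * u / (2 * jacobi_K \<tau>)))"
| "jacobi_pn \<tau> letter_c u = theta4 \<tau> 0 / theta2 \<tau> 0 *
     (theta2 \<tau> (of_real pi * u / (2 * jacobi_K \<tau>)) / theta4 \<tau> (of_real pi * u / (2 * jacobi_K \<tau>)))"
| "jacobi_pn \<tau> letter_d u = theta4 \<tau> 0 / theta3 \<tau> 0 *
     (theta3 \<tau> (of_real pi * u / (2 * jacobi_K \<tau>)) / theta4 \<tau> (of_real pi * u / (2 * jacobi_K \<tau>)))"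
| "jacobi_pn \<tau> letter_n u = 1"

(* The function pq = pn / qn, as a quotient of meromorphic functions: the pointwise quotient has
   removable singularities (for instance cn / sn at the common poles of sn and cn), where
   remove_sings puts the correct value. *)

definition jacobi :: "complex \<Rightarrow> letter \<Rightarrow> letter \<Rightarrow> complex \<Rightarrow> complex" where
  "jacobi \<tau> p q = remove_sings (\<lambda>u. jacobi_pn \<tau> p u / jacobi_pn \<tau> q u)"

definition jacobi_functions :: "complex \<Rightarrow> (complex \<Rightarrow> complex) set" where
  "jacobi_functions \<tau> = {jacobi \<tau> p q | p q. p \<noteq> q}"

definition pole_class :: "complex \<Rightarrow> letter \<Rightarrow> (complex \<Rightarrow> complex) set" where
  "pole_class \<tau> p = {jacobi \<tau> q p | q. q \<noteq> p}"

(* Meant for orders b \<ge> 1 and b = -1 only; order -1 denotes the constant function 1. *)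

definition ext_deriv :: "int \<Rightarrow> (complex \<Rightarrow> complex) \<Rightarrow> complex \<Rightarrow> complex" where
  "ext_deriv b f = (if b = -1 then (\<lambda>u. 1) else (deriv ^^ nat b) f)"

definition Max_or_zero :: "int set \<Rightarrow> int" where
  "Max_or_zero A = (if A = {} then 0 else Max A)"

end

theory Submission
  imports Defs
begin

text \<open>Put \<open>v = \<pi> u / 2K\<close> and \<open>n = N + 1\<close>.  If \<open>4 M p\<close> is the maximum attached to the letter \<open>p\<close>, then
  multiplying every column function by \<open>W = (\<Prod>p. \<theta>\<^sub>p(v) ^ M p)\<close> turns it into an entire function \<open>H\<close> with
  \<open>H(v + 2\<pi>) = H(v)\<close> and \<open>H(v + 2\<pi>\<tau>) = exp (- \<i> n (v + \<pi>\<tau>)) H(v)\<close>, and \<open>W\<close> does not vanish at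
  points that are no poles, because distinct theta functions have no common zero (Jacobi triple product).
  The second relation forces the Fourier coefficients of \<open>H\<close> to be
  \<open>b\<^sub>m exp (\<pi> \<i> \<tau> m\<^sup>2 / n)\<close> with \<open>b\<close> periodic modulo the even number \<open>n\<close>.  Expanding
  \<open>det (H\<^sub>j(v\<^sub>i))\<close> as a sum over frequency vectors \<open>m \<in> \<int>\<^sup>n\<close>, where \<open>\<Sum>v\<^sub>i = 0\<close>, the involution
  \<open>m\<^sub>i \<mapsto> m\<^sub>i - 2S/n\<close> with \<open>S = \<Sum>m\<^sub>i\<close> preserves the exponentials.  On the
  terms that do not vanish the shift \<open>2S/n\<close> is an odd integer, so the determinant of the \<open>b\<close>-values changes sign and
  the terms cancel in pairs.\<close>

section \<open>Fourier series of entire functions\<close>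

text \<open>Convergence is asked at every complex \<open>v\<close> and is unconditional, so
  \<open>H\<close> is entire and has period 2 pi. This encodes the first of the two transformation
  laws.\<close>

definition has_fourier :: "(int \<Rightarrow> complex) \<Rightarrow> (complex \<Rightarrow> complex) \<Rightarrow> bool" where
  "has_fourier a H \<longleftrightarrow> (\<forall>v. ((\<lambda>m. a m * exp (\<i> * of_int m * v)) has_sum H v) UNIV)"

lemma has_fourier_abs_summable:
  assumes "has_fourier a H"
  shows "(\<lambda>m. norm (a m * exp (\<i> * of_int m * v))) summable_on UNIV"
proof -
  have "(\<lambda>m. a m * exp (\<i> * of_int m * v)) summable_on UNIV"
    using assms unfolding has_fourier_def summable_on_def by blast
  thus ?thesis by (simp add: summable_on_iff_abs_summable_on_complex)
qed

lemma has_fourierI: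
  assumes "\<And>v. (\<lambda>m. a m * exp (\<i> * of_int m * v)) summable_on UNIV"
    and "\<And>v. H v = (\<Sum>\<^sub>\<infinity>m. a m * exp (\<i> * of_int m * v))"
  shows "has_fourier a H"
  unfolding has_fourier_def assms(2) by (intro allI has_sum_infsum assms(1))

lemma has_fourier_add:
  assumes "has_fourier a F" "has_fourier b G"
  shows "has_fourier (\<lambda>m. a m + b m) (\<lambda>v. F v + G v)"
  using assms unfolding has_fourier_def by (auto simp: ring_distribs intro!: has_sum_add)

lemma has_fourier_cmult:
  assumes "has_fourier a F"
  shows "has_fourier (\<lambda>m. c * a m) (\<lambda>v. c * F v)"
  using assms unfolding has_fourier_def by (auto simp: mult.assoc intro!: has_sum_cmult_right)

lemma has_fourier_shift:
  assumes "has_fourier a F"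
  shows "has_fourier (\<lambda>m. a m * exp (\<i> * of_int m * c)) (\<lambda>v. F (v + c))"
proof -
  have "(\<lambda>m. a m * exp (\<i> * of_int m * c) * exp (\<i> * of_int m * v)) =
    (\<lambda>m. a m * exp (\<i> * of_int m * (v + c)))" for v
    by (simp add: ring_distribs exp_add mult_ac)
  thus ?thesis using assms unfolding has_fourier_def by simp
qed

lemma has_fourier_reflect:
  assumes "has_fourier a F"
  shows "has_fourier (\<lambda>m. a (- m)) (\<lambda>v. F (- v))"
  unfolding has_fourier_def
proof
  fix v
  have "((\<lambda>m. a m * exp (\<i> * of_int m * (-v))) has_sum F (-v)) UNIV"
    using assms unfolding has_fourier_def by blast
  also have "?this \<longleftrightarrow> ((\<lambda>m. a (-m) * exp (\<i> * of_int m * v)) has_sum F (-v)) UNIV"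
    by (rule has_sum_reindex_bij_witness[of _ uminus uminus]) auto
  finally show "((\<lambda>m. a (-m) * exp (\<i> * of_int m * v)) has_sum F (-v)) UNIV" .
qed

text \<open>Cauchy product: both series converge absolutely, so the double series may be regrouped
  by the total frequency \<open>x + y\<close>.\<close>

lemma has_fourier_mult:
  assumes a: "has_fourier a F" and b: "has_fourier b G"
  shows "has_fourier (\<lambda>m. \<Sum>\<^sub>\<infinity>k. a k * b (m - k)) (\<lambda>v. F v * G v)"
proof (rule has_fourierI)
  fix v
  define f where "f = (\<lambda>m. a m * exp (\<i> * of_int m * v))"
  define g where "g = (\<lambda>m. b m * exp (\<i> * of_int m * v))"
  have abs: "(\<lambda>m. norm (f m)) summable_on UNIV" "(\<lambda>m. norm (g m)) summable_on UNIV"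
    using has_fourier_abs_summable[OF a] has_fourier_abs_summable[OF b] by (auto simp: f_def g_def)
  have fg: "(f has_sum F v) UNIV" "(g has_sum G v) UNIV"
    using a b by (auto simp: f_def g_def has_fourier_def)
  have prod: "(\<lambda>x. norm (case x of (x, y) \<Rightarrow> f x * g y)) summable_on UNIV \<times> UNIV"
    using abs_summable_on_product[of UNIV UNIV f g] abs
    by (simp add: abs_summable_equivalent del: UNIV_Times_UNIV)
  hence prod: "(\<lambda>(x, y). f x * g y) summable_on UNIV \<times> UNIV"
    by (rule abs_summable_summable)
  have val: "(\<Sum>\<^sub>\<infinity>(x, y)\<in>UNIV \<times> UNIV. f x * g y) = F v * G v"
    using infsum_Sigma'_banach[OF prod] fg
    by (simp add: infsum_cmult_right' infsum_cmult_left' infsumI)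
  have "((\<lambda>(x, y). f x * g y) has_sum F v * G v) (UNIV \<times> UNIV)"
    using prod val has_sum_infsum by metis
  also have "?this \<longleftrightarrow> ((\<lambda>(m, k). f k * g (m - k)) has_sum F v * G v) (UNIV \<times> UNIV)"
    by (rule has_sum_reindex_bij_witness[of _ "\<lambda>(m, k). (k, m - k)" "\<lambda>(x, y). (x + y, x)"]) auto
  finally have S: "((\<lambda>(m, k). f k * g (m - k)) has_sum F v * G v) (UNIV \<times> UNIV)" .
  have *: "(\<Sum>\<^sub>\<infinity>k. f k * g (m - k)) = (\<Sum>\<^sub>\<infinity>k. a k * b (m - k)) * exp (\<i> * of_int m * v)" for m
  proof -
    have "(\<Sum>\<^sub>\<infinity>k. f k * g (m - k)) = (\<Sum>\<^sub>\<infinity>k. a k * b (m - k) * exp (\<i> * of_int m * v))"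
    proof (rule infsum_cong)
      fix k
      have "exp (\<i> * of_int k * v) * exp (\<i> * of_int (m - k) * v) = exp (\<i> * of_int m * v)"
        by (simp add: algebra_simps flip: exp_add)
      thus "f k * g (m - k) = a k * b (m - k) * exp (\<i> * of_int m * v)"
        by (simp add: f_def g_def mult_ac)
    qed
    also have "\<dots> = (\<Sum>\<^sub>\<infinity>k. a k * b (m - k)) * exp (\<i> * of_int m * v)"
      by (rule infsum_cmult_left')
    finally show ?thesis .
  qed
  show "F v * G v = (\<Sum>\<^sub>\<infinity>m. (\<Sum>\<^sub>\<infinity>k. a k * b (m - k)) * exp (\<i> * of_int m * v))"
    using S infsum_Sigma'_banach[of "\<lambda>m k. f k * g (m - k)" UNIV "\<lambda>_. UNIV"]
    by (simp add: infsumI * has_sum_imp_summable)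
  show "(\<lambda>m. (\<Sum>\<^sub>\<infinity>k. a k * b (m - k)) * exp (\<i> * of_int m * v)) summable_on UNIV"
    using summable_on_Sigma_banach[of "\<lambda>m k. f k * g (m - k)" UNIV "\<lambda>_. UNIV"] S
    by (simp add: * has_sum_imp_summable)
qed

text \<open>A Fourier series is a Laurent series in \<open>exp (\<i> * v)\<close>. Its halves of
  nonnegative and of negative frequency are entire power series, so that facts about power series
  carry over.\<close>

lemma has_fourier_decomp:
  assumes "has_fourier a H"
  obtains f g :: "complex fps"
  where "fps_conv_radius f = \<infinity>" "fps_conv_radius g = \<infinity>"
    "\<And>k. fps_nth f k = a (int k)" "\<And>k. fps_nth g k = (if k = 0 then 0 else a (- int k))"
    "\<And>v. H v = eval_fps f (exp (\<i> * v)) + eval_fps g (exp (- \<i> * v))"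
proof -
  define f where "f = Abs_fps (\<lambda>k. a (int k))"
  define g where "g = Abs_fps (\<lambda>k. if k = 0 then 0 else a (- int k))"
  have sum: "((\<lambda>k. fps_nth f k * exp (\<i> * v) ^ k) has_sum (\<Sum>\<^sub>\<infinity>m\<in>{0..}. a m * exp (\<i> * of_int m * v))) UNIV"
    "((\<lambda>k. fps_nth g k * exp (- \<i> * v) ^ k) has_sum (\<Sum>\<^sub>\<infinity>m\<in>{..<0}. a m * exp (\<i> * of_int m * v))) UNIV"
    (is ?th2)
    "H v = (\<Sum>\<^sub>\<infinity>m\<in>{0..}. a m * exp (\<i> * of_int m * v)) + (\<Sum>\<^sub>\<infinity>m\<in>{..<0}. a m * exp (\<i> * of_int m * v))" for v
  proof -
    define h where "h = (\<lambda>m. a m * exp (\<i> * of_int m * v))"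
    have h: "(h has_sum H v) UNIV" using assms by (simp add: has_fourier_def h_def)
    hence su: "h summable_on A" for A
      using has_sum_imp_summable summable_on_subset_banach by blast
    have "(h has_sum infsum h {0..}) {0..}" using su by simp
    also have "?this \<longleftrightarrow> ((\<lambda>k. fps_nth f k * exp (\<i> * v) ^ k) has_sum infsum h {0..}) UNIV"
      by (rule has_sum_reindex_bij_witness[of _ int nat])
         (auto simp: f_def h_def mult_ac simp flip: exp_of_nat_mult)
    finally show "((\<lambda>k. fps_nth f k * exp (\<i> * v) ^ k) has_sum infsum h {0..}) UNIV" .
    have "(h has_sum infsum h {..<0}) {..<0}" using su by simp
    \<comment> \<open>Negative frequencies correspond to \<open>k \<ge> 1\<close>. Index 0 can be
      added afterwards because the constant coefficient of \<open>g\<close> is 0.\<close>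
    also have "?this \<longleftrightarrow> ((\<lambda>k. fps_nth g k * exp (-\<i> * v) ^ k) has_sum infsum h {..<0}) {1..}"
      by (rule has_sum_reindex_bij_witness[of _ "\<lambda>k. - int k" "\<lambda>m. nat (- m)"])
         (auto simp: g_def h_def mult_ac simp flip: exp_of_nat_mult)
    also have "\<dots> \<longleftrightarrow> ((\<lambda>k. fps_nth g k * exp (-\<i> * v) ^ k) has_sum infsum h {..<0}) UNIV"
      by (rule has_sum_cong_neutral) (auto simp: g_def)
    finally show "((\<lambda>k. fps_nth g k * exp (-\<i> * v) ^ k) has_sum infsum h {..<0}) UNIV" .
    have "(h has_sum (infsum h {0..} + infsum h {..<0})) ({0..} \<union> {..<0})"
      using su by (intro has_sum_Un_disjoint) auto
    also have "{0..} \<union> {..<0::int} = UNIV" by auto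
    finally show "H v = infsum h {0..} + infsum h {..<0}"
      using h has_sum_unique by blast
  qed
  \<comment> \<open>\<open>exp (c * v)\<close> takes every nonzero value, so the power series
    converges on the whole plane.\<close>
  have rad: "fps_conv_radius F = \<infinity>"
    if "\<And>v. (\<lambda>k. fps_nth F k * exp (c * v) ^ k) summable_on UNIV" "c \<noteq> 0"
    for F :: "complex fps" and c
    unfolding fps_conv_radius_def
  proof (rule conv_radius_inftyI'')
    fix z
    show "summable (\<lambda>n. fps_nth F n * z ^ n)"
    proof (cases "z = 0")
      case False
      thus ?thesis using that(1)[of "Ln z / c"] that(2)
        by (simp add: summable_on_imp_summable)
    qed (simp add: summable_0_powser)
  qed
  have R: "fps_conv_radius f = \<infinity>" "fps_conv_radius g = \<infinity>"
    by (rule rad[of _ \<i>] rad[of _ "- \<i>"], rule has_sum_imp_summable[OF sum(1)] has_sum_imp_summable[OF sum(2)], simp)+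
  have "H v = eval_fps f (exp (\<i> * v)) + eval_fps g (exp (- \<i> * v))" for v
    using has_sum_imp_sums[OF sum(1)[of v]] has_sum_imp_sums[OF sum(2)[of v]] sum(3)[of v]
    by (simp add: eval_fps_def sums_iff)
  thus ?thesis using that[of f g] R by (simp add: f_def g_def)
qed

lemma has_fourier_eval_fps:
  fixes f :: "complex fps"
  assumes "fps_conv_radius f = \<infinity>"
  shows "has_fourier (\<lambda>m. if m \<ge> 0 then fps_nth f (nat m) else 0) (\<lambda>v. eval_fps f (exp (\<i> * v)))"
  unfolding has_fourier_def
proof
  fix v
  have *: "norm (exp (\<i> * v)) < fps_conv_radius f" using assms by simp
  have "((\<lambda>k. fps_nth f k * exp (\<i> * v) ^ k) has_sum eval_fps f (exp (\<i> * v))) UNIV"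
    using norm_summable_fps[OF *] sums_eval_fps[of "exp (\<i> * v)" f] *
    by (intro norm_summable_imp_has_sum)
  also have "?this \<longleftrightarrow> ((\<lambda>m. (if m \<ge> 0 then fps_nth f (nat m) else 0) * exp (\<i> * of_int m * v))
    has_sum eval_fps f (exp (\<i> * v))) {0..}"
    by (rule has_sum_reindex_bij_witness[of _ nat int])
         (auto simp: mult_ac simp flip: exp_of_nat_mult)
  also have "\<dots> \<longleftrightarrow> ((\<lambda>m. (if m \<ge> 0 then fps_nth f (nat m) else 0) * exp (\<i> * of_int m * v))
    has_sum eval_fps f (exp (\<i> * v))) UNIV"
    by (rule has_sum_cong_neutral) auto
  finally show "((\<lambda>m. (if m \<ge> 0 then fps_nth f (nat m) else 0) * exp (\<i> * of_int m * v))
    has_sum eval_fps f (exp (\<i> * v))) UNIV" .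
qed

lemma has_fourier_holomorphic:
  assumes "has_fourier a H"
  shows "H holomorphic_on A"
proof -
  obtain f g :: "complex fps" where fg: "fps_conv_radius f = \<infinity>" "fps_conv_radius g = \<infinity>"
    "\<And>v. H v = eval_fps f (exp (\<i> * v)) + eval_fps g (exp (- \<i> * v))"
    using has_fourier_decomp[OF assms] by metis
  have "(\<lambda>v. eval_fps f (exp (\<i> * v)) + eval_fps g (exp (- \<i> * v))) holomorphic_on A"
    using fg by (intro holomorphic_intros holomorphic_on_compose_gen[of _ _ "eval_fps f" UNIV, unfolded o_def]
      holomorphic_on_compose_gen[of _ _ "eval_fps g" UNIV, unfolded o_def]) auto
  also have "(\<lambda>v. eval_fps f (exp (\<i> * v)) + eval_fps g (exp (- \<i> * v))) = H" using fg by auto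
  finally show ?thesis .
qed

text \<open>On the punctured plane \<open>f(x) = - g(1/x)\<close>, and \<open>g(1/x)\<close> tends
  to \<open>g(0) = 0\<close> at infinity. So the entire function \<open>f\<close> vanishes at
  infinity and is 0 by Liouville's theorem; then \<open>g\<close> is 0 as well.\<close>

lemma has_fourier_0_unique:
  assumes "has_fourier a (\<lambda>_. 0)"
  shows "a m = 0"
proof -
  obtain f g :: "complex fps" where fg: "fps_conv_radius f = \<infinity>" "fps_conv_radius g = \<infinity>"
    and nth: "\<And>k. fps_nth f k = a (int k)" "\<And>k. fps_nth g k = (if k = 0 then 0 else a (- int k))"
    and sum: "\<And>v. 0 = eval_fps f (exp (\<i> * v)) + eval_fps g (exp (- \<i> * v))"
    using has_fourier_decomp[OF assms] by metis
  have eq: "eval_fps f x = - eval_fps g (inverse x)" if "x \<noteq> 0" for x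
    using sum[of "Ln x / \<i>"] that by (simp add: eq_neg_iff_add_eq_0 exp_minus)
  have holo: "eval_fps f holomorphic_on UNIV" "eval_fps g holomorphic_on UNIV"
    using fg by (auto intro!: holomorphic_intros)
  have "isCont (eval_fps g) 0" using fg(2) by (intro continuous_eval_fps) simp
  moreover have "eval_fps g 0 = 0" by (simp add: eval_fps_at_0 nth)
  ultimately have "((\<lambda>x. - eval_fps g (inverse x)) \<longlongrightarrow> - 0) at_infinity"
    by (intro tendsto_minus) (metis isCont_tendsto_compose tendsto_inverse_0)
  also have "?this \<longleftrightarrow> (eval_fps f \<longlongrightarrow> - 0) at_infinity"
    by (rule filterlim_cong) (auto simp: eventually_at_infinity intro!: exI[of _ 1] eq[symmetric])
  finally have f0: "eval_fps f x = 0" for x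
    using Liouville_weak_0[OF holo(1)] by simp
  have g0: "eval_fps g x = 0" for x
  proof (cases "x = 0")
    case True thus ?thesis by (simp add: eval_fps_at_0 nth)
  next
    case False thus ?thesis using eq[of "inverse x"] f0 by simp
  qed
  have "f = 0" "g = 0"
    by (rule eval_fps_eqD; use fg f0 g0 in simp)+
  thus ?thesis using nth(1)[of "nat m"] nth(2)[of "nat (-m)"] by (cases "m \<ge> 0") auto
qed

lemma has_fourier_unique:
  assumes "has_fourier a H" "has_fourier b H"
  shows "a = b"
proof
  fix m
  have "has_fourier (\<lambda>m. a m + (-1) * b m) (\<lambda>v. H v + (-1) * H v)"
    by (intro has_fourier_add has_fourier_cmult assms)
  hence "has_fourier (\<lambda>m. a m + (-1) * b m) (\<lambda>v. 0)" by simp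
  from has_fourier_0_unique[OF this, of m] show "a m = b m" by simp
qed

definition fourier :: "(complex \<Rightarrow> complex) \<Rightarrow> bool" where
  "fourier H \<longleftrightarrow> (\<exists>a. has_fourier a H)"

lemma fourier_deriv:
  assumes "fourier H"
  shows "fourier (deriv H)"
proof -
  obtain f g :: "complex fps" where fg: "fps_conv_radius f = \<infinity>" "fps_conv_radius g = \<infinity>"
    "\<And>v. H v = eval_fps f (exp (\<i> * v)) + eval_fps g (exp (- \<i> * v))"
    using has_fourier_decomp assms unfolding fourier_def by metis
  have H: "H = (\<lambda>v. eval_fps f (exp (\<i> * v)) + eval_fps g (exp (- \<i> * v)))" using fg by auto
  \<comment> \<open>With \<open>x = exp (\<i> * v)\<close>, the derivation d/dv is i x d/dx; on the
    half in 1/x the sign is reversed.\<close>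
  define f' where "f' = fps_const \<i> * fps_X * fps_deriv f"
  define g' where "g' = fps_const (- \<i>) * fps_X * fps_deriv g"
  have rd: "fps_conv_radius (fps_deriv f) = \<infinity>" "fps_conv_radius (fps_deriv g) = \<infinity>"
    using fps_conv_radius_deriv[of f] fps_conv_radius_deriv[of g] fg by auto
  have r1: "fps_conv_radius (fps_const c * fps_X * F) = \<infinity>" if "fps_conv_radius F = \<infinity>" for F and c :: complex
  proof -
    have "fps_conv_radius (fps_const c * fps_X) = \<infinity>"
      using fps_conv_radius_mult[of "fps_const c" "fps_X"] by simp
    thus ?thesis using fps_conv_radius_mult[of "fps_const c * fps_X" F] that by simp
  qed
  have rc: "fps_conv_radius (fps_const c * fps_X) = \<infinity>" for c :: complex
    using fps_conv_radius_mult[of "fps_const c" "fps_X"] by simp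
  have ev: "eval_fps (fps_const c * fps_X * F) z = c * z * eval_fps F z"
    if "fps_conv_radius F = \<infinity>" for F and c z :: complex
    using that rc by (simp add: eval_fps_mult)
  have D: "deriv H v = eval_fps f' (exp (\<i> * v)) + eval_fps g' (exp (- \<i> * v))" for v
    unfolding H f'_def g'_def
    by (rule DERIV_imp_deriv) (use fg in \<open>auto intro!: derivative_eq_intros
      DERIV_chain'[OF _ has_field_derivative_eval_fps] simp: ev rd\<close>)
  have "has_fourier (\<lambda>m. if m \<ge> 0 then fps_nth f' (nat m) else 0) (\<lambda>v. eval_fps f' (exp (\<i> * v)))"
    "has_fourier (\<lambda>m. if m \<ge> 0 then fps_nth g' (nat m) else 0) (\<lambda>v. eval_fps g' (exp (\<i> * v)))"
    using rd by (intro has_fourier_eval_fps; simp add: f'_def g'_def r1)+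
  from has_fourier_add[OF this(1) has_fourier_reflect[OF this(2)]]
  show ?thesis unfolding fourier_def D[abs_def] by auto
qed

section \<open>Spaces of theta functions\<close>

lemma has_fourier_exp_mult:
  assumes "has_fourier a F"
  shows "has_fourier (\<lambda>m. a (m - k)) (\<lambda>v. exp (\<i> * of_int k * v) * F v)"
  unfolding has_fourier_def
proof
  fix v
  have "((\<lambda>m. exp (\<i> * of_int k * v) * (a m * exp (\<i> * of_int m * v))) has_sum exp (\<i> * of_int k * v) * F v) UNIV"
    using assms unfolding has_fourier_def by (intro has_sum_cmult_right) auto
  also have "?this \<longleftrightarrow> ((\<lambda>m. a (m - k) * exp (\<i> * of_int m * v)) has_sum exp (\<i> * of_int k * v) * F v) UNIV"
    by (rule has_sum_reindex_bij_witness[of _ "\<lambda>m. m - k" "\<lambda>m. m + k"])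
       (auto simp: algebra_simps exp_add)
  finally show "((\<lambda>m. a (m - k) * exp (\<i> * of_int m * v)) has_sum exp (\<i> * of_int k * v) * F v) UNIV" .
qed

lemma fourier_const: "fourier (\<lambda>_. c)"
  unfolding fourier_def using has_fourier_eval_fps[of "fps_const c"] by auto

lemma fourier_add: "fourier F \<Longrightarrow> fourier G \<Longrightarrow> fourier (\<lambda>v. F v + G v)"
  unfolding fourier_def using has_fourier_add by blast

lemma fourier_mult: "fourier F \<Longrightarrow> fourier G \<Longrightarrow> fourier (\<lambda>v. F v * G v)"
  unfolding fourier_def using has_fourier_mult by blast

lemma fourier_shift: "fourier F \<Longrightarrow> fourier (\<lambda>v. F (v + c))"
  unfolding fourier_def using has_fourier_shift by blast

lemma fourier_holomorphic: "fourier F \<Longrightarrow> F holomorphic_on A"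
  unfolding fourier_def using has_fourier_holomorphic by blast

text \<open>Theta functions of degree \<open>n\<close>. The translations are 2 pi and 2 pi tau,
  twice the quasi-periods of the Jacobi theta functions: the signs by which the four transformation
  laws differ then disappear, and all four have degree 4.\<close>

definition theta_space :: "complex \<Rightarrow> nat \<Rightarrow> (complex \<Rightarrow> complex) set" where
  "theta_space \<tau> n = {H. fourier H \<and>
     (\<forall>v. H (v + 2 * of_real pi * \<tau>) = exp (- \<i> * of_nat n * (v + of_real pi * \<tau>)) * H v)}"

lemma theta_space_fourier: "H \<in> theta_space \<tau> n \<Longrightarrow> fourier H"
  by (simp add: theta_space_def)

lemma theta_space_const: "(\<lambda>_. c) \<in> theta_space \<tau> 0"
  by (simp add: theta_space_def fourier_const)

lemma theta_space_add:
  "F \<in> theta_space \<tau> n \<Longrightarrow> G \<in> theta_space \<tau> n \<Longrightarrow> (\<lambda>v. F v + G v) \<in> theta_space \<tau> n"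
  by (simp add: theta_space_def fourier_add ring_distribs)

lemma theta_space_mult:
  assumes "F \<in> theta_space \<tau> m" "G \<in> theta_space \<tau> n"
  shows "(\<lambda>v. F v * G v) \<in> theta_space \<tau> (m + n)"
proof -
  have "exp (- \<i> * of_nat (m + n) * w) = exp (- \<i> * of_nat m * w) * exp (- \<i> * of_nat n * w)" for w
    by (simp add: algebra_simps flip: exp_add)
  thus ?thesis using assms by (simp add: theta_space_def fourier_mult)
qed

lemma theta_space_cmult:
  "F \<in> theta_space \<tau> n \<Longrightarrow> (\<lambda>v. c * F v) \<in> theta_space \<tau> n"
  using theta_space_mult[OF theta_space_const] by fastforce

lemma theta_space_power:
  "F \<in> theta_space \<tau> n \<Longrightarrow> (\<lambda>v. F v ^ k) \<in> theta_space \<tau> (k * n)"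
  by (induction k) (auto intro: theta_space_const theta_space_mult)

lemma theta_space_prod:
  assumes "finite I" "\<And>i. i \<in> I \<Longrightarrow> F i \<in> theta_space \<tau> (n i)"
  shows "(\<lambda>v. \<Prod>i\<in>I. F i v) \<in> theta_space \<tau> (\<Sum>i\<in>I. n i)"
  using assms by (induction I rule: finite_induct) (auto intro: theta_space_const theta_space_mult)

lemma theta_space_0: "(\<lambda>_. 0) \<in> theta_space \<tau> n"
  by (simp add: theta_space_def fourier_const)

text \<open>Differentiating the multiplier produces the term with \<open>F v\<close>, the
  obstruction to \<open>deriv F\<close> lying in the space; Wronskian combinations cancel
  it.\<close>

lemma theta_space_deriv:
  assumes F: "F \<in> theta_space \<tau> n"
  shows "deriv F (v + 2 * of_real pi * \<tau>) =
    exp (- \<i> * of_nat n * (v + of_real pi * \<tau>)) * (deriv F v - \<i> * of_nat n * F v)"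
proof -
  define E where "E = (\<lambda>v. exp (- \<i> * of_nat n * (v + of_real pi * \<tau>)))"
  have D: "(F has_field_derivative deriv F w) (at w)" for w
    using fourier_holomorphic[OF theta_space_fourier[OF F]] by (intro holomorphic_derivI[of _ UNIV]) auto
  have "((\<lambda>v. F (v + 2 * of_real pi * \<tau>)) has_field_derivative deriv F (v + 2 * of_real pi * \<tau>)) (at v)"
    by (subst DERIV_shift[symmetric]) (rule D)
  moreover have "((\<lambda>v. E v * F v) has_field_derivative (E v * (deriv F v - \<i> * of_nat n * F v))) (at v)"
    unfolding E_def by (auto intro!: derivative_eq_intros D simp: algebra_simps)
  moreover have "(\<lambda>v. F (v + 2 * of_real pi * \<tau>)) = (\<lambda>v. E v * F v)"
    using F by (auto simp: theta_space_def E_def)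
  ultimately show ?thesis unfolding E_def by (metis (no_types, lifting) DERIV_unique)
qed

text \<open>The numerator of \<open>(F / G\<^sup>k)'\<close> when \<open>m = k n\<close>: the inhomogeneous parts of the
  transformation laws of \<open>F'\<close> and \<open>G'\<close> cancel.\<close>

lemma theta_space_wronskian:
  assumes F: "F \<in> theta_space \<tau> m" and G: "G \<in> theta_space \<tau> n"
  shows "(\<lambda>v. of_nat n * (deriv F v * G v) - of_nat m * (F v * deriv G v)) \<in> theta_space \<tau> (m + n)"
proof -
  have four: "fourier (\<lambda>v. of_nat n * (deriv F v * G v) + (- of_nat m) * (F v * deriv G v))"
    using theta_space_fourier[OF F] theta_space_fourier[OF G]
    by (intro fourier_add fourier_mult fourier_const fourier_deriv)
  have E: "exp (- \<i> * of_nat (m + n) * w) = exp (- \<i> * of_nat m * w) * exp (- \<i> * of_nat n * w)" for w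
    by (simp add: algebra_simps flip: exp_add)
  have FG: "F (v + 2 * of_real pi * \<tau>) = exp (- \<i> * of_nat m * (v + of_real pi * \<tau>)) * F v"
    "G (v + 2 * of_real pi * \<tau>) = exp (- \<i> * of_nat n * (v + of_real pi * \<tau>)) * G v" for v
    using F G by (auto simp: theta_space_def)
  show ?thesis using four
    unfolding theta_space_def mem_Collect_eq FG theta_space_deriv[OF F] theta_space_deriv[OF G] E
    by (auto simp: algebra_simps)
qed

text \<open>Comparing Fourier coefficients in the transformation law gives a recursion from
  \<open>a (m - n)\<close> to \<open>a m\<close>. The Gaussian factor solves this recursion, so the
  quotient \<open>b\<close> of \<open>a\<close> by it is periodic.\<close>

lemma theta_space_coeffs:
  assumes H: "H \<in> theta_space \<tau> n" and n: "n > 0"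
  obtains b where "\<And>m. b (m + int n) = b m"
    "has_fourier (\<lambda>m. b m * exp (of_real pi * \<i> * \<tau> * (of_int m)\<^sup>2 / of_nat n)) H"
proof -
  obtain a where a: "has_fourier a H" using H by (auto simp: theta_space_def fourier_def)
  have per: "H (v + 2 * of_real pi * \<tau>) = exp (- \<i> * of_nat n * (v + of_real pi * \<tau>)) * H v" for v
    using H by (auto simp: theta_space_def)
  \<comment> \<open>The two exponential prefactors undo the multiplier, so the function is
    \<open>H\<close> again; multiplication by \<open>exp (\<i> * n * v)\<close> moves every
    frequency up by \<open>n\<close>.\<close>
  have "has_fourier (\<lambda>m. exp (\<i> * of_nat n * of_real pi * \<tau>) * (a (m - int n) * exp (\<i> * of_int (m - int n) * (2 * of_real pi * \<tau>))))
    (\<lambda>v. exp (\<i> * of_nat n * of_real pi * \<tau>) * (exp (\<i> * of_int (int n) * v) * H (v + 2 * of_real pi * \<tau>)))"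
    by (rule has_fourier_cmult[OF has_fourier_exp_mult[OF has_fourier_shift[OF a]]])
  also have "(\<lambda>v. exp (\<i> * of_nat n * of_real pi * \<tau>) * (exp (\<i> * of_int (int n) * v) * H (v + 2 * of_real pi * \<tau>))) = H"
  proof
    fix v
    have "exp (\<i> * of_nat n * of_real pi * \<tau>) * (exp (\<i> * of_int (int n) * v) * exp (- \<i> * of_nat n * (v + of_real pi * \<tau>))) = 1"
      by (simp add: algebra_simps flip: exp_add)
    thus "exp (\<i> * of_nat n * of_real pi * \<tau>) * (exp (\<i> * of_int (int n) * v) * H (v + 2 * of_real pi * \<tau>)) = H v"
      unfolding per mult.assoc[symmetric] by simp
  qed
  finally have eq: "a = (\<lambda>m. exp (\<i> * of_nat n * of_real pi * \<tau>) * (a (m - int n) * exp (\<i> * of_int (m - int n) * (2 * of_real pi * \<tau>))))"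
    by (intro has_fourier_unique[OF a])
  define c where "c = (\<lambda>m::int. of_real pi * \<i> * \<tau> * (of_int m)\<^sup>2 / of_nat n)"
  define b where "b = (\<lambda>m. a m * exp (- c m))"
  show ?thesis
  proof (rule that)
    fix m
    have "a (m + int n) = exp (\<i> * of_nat n * of_real pi * \<tau>) * (a m * exp (\<i> * of_int m * (2 * of_real pi * \<tau>)))"
      by (subst eq) simp
    hence "b (m + int n) = a m * exp (\<i> * of_nat n * of_real pi * \<tau> + \<i> * of_int m * (2 * of_real pi * \<tau>) - c (m + int n))"
      by (simp add: b_def exp_add exp_diff exp_minus field_simps)
    also have "\<i> * of_nat n * of_real pi * \<tau> + \<i> * of_int m * (2 * of_real pi * \<tau>) - c (m + int n) = - c m"
      using n by (simp add: c_def field_simps power2_eq_square)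
    finally show "b (m + int n) = b m" by (simp add: b_def)
  next
    have "(\<lambda>m. b m * exp (c m)) = a" by (simp add: b_def mult.assoc flip: exp_add)
    thus "has_fourier (\<lambda>m. b m * exp (of_real pi * \<i> * \<tau> * (of_int m)\<^sup>2 / of_nat n)) H"
      using a by (simp add: c_def)
  qed
qed

section \<open>The determinant of theta functions of even degree\<close>

text \<open>A cycle on the \<open>n + 1\<close> points 0, ..., n, hence of sign
  \<open>(-1) ^ n\<close>.\<close>

definition rot :: "nat \<Rightarrow> nat \<Rightarrow> nat" where
  "rot n i = (if i < n then Suc i else if i = n then 0 else i)"

lemma rot_Suc: "rot (Suc n) = Transposition.transpose 0 (Suc n) \<circ> rot n"
  by (auto simp: fun_eq_iff rot_def Transposition.transpose_def)

lemma rot_permutes: "rot n permutes {0..<Suc n}"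
proof (induction n)
  case 0
  have "rot 0 = id" by (auto simp: fun_eq_iff rot_def)
  thus ?case using permutes_id by metis
next
  case (Suc n)
  have "rot n permutes {0..<Suc (Suc n)}"
    by (rule permutes_subset[OF Suc]) auto
  thus ?case unfolding rot_Suc
    by (intro permutes_compose permutes_swap_id) auto
qed

lemma sign_rot: "sign (rot n) = (-1) ^ n"
proof (induction n)
  case 0
  have "rot 0 = id" by (auto simp: fun_eq_iff rot_def)
  thus ?case by simp
next
  case (Suc n)
  have "permutation (rot n)" using rot_permutes permutes_imp_permutation by blast
  thus ?case unfolding rot_Suc using Suc
    by (subst sign_compose) (auto simp: permutation_swap_id sign_swap_id)
qed

text \<open>Rows with residues \<open>m i mod n\<close> permute the rows of one fixed matrix, and adding 1 to every
  residue is an \<open>n\<close>-cycle, which is odd because \<open>n\<close> is even.\<close>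

locale periodic_rows =
  fixes n :: nat and b :: "nat \<Rightarrow> int \<Rightarrow> complex"
  assumes n: "n > 0" "even n" and per: "\<And>j m. j < n \<Longrightarrow> b j (m + int n) = b j m"
begin

text \<open>The determinant that remains at the frequency vector \<open>m\<close> once the
  exponentials are taken out of the rows.\<close>

definition rdet :: "(nat \<Rightarrow> int) \<Rightarrow> complex" where
  "rdet m = Determinant.det (Matrix.mat n n (\<lambda>(i, j). b j (m i)))"

lemma per_mult: "j < n \<Longrightarrow> b j (m + int n * k) = b j m"
proof (induction k arbitrary: m rule: int_induct[of _ 0])
  case base thus ?case by simp
next
  case (step1 i)
  thus ?case using per[of j "m + int n * i"] by (simp add: algebra_simps)
next
  case (step2 i)
  thus ?case using per[of j "m + int n * (i - 1)"] by (simp add: algebra_simps)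
qed

lemma per_mod: "j < n \<Longrightarrow> b j (m mod int n) = b j m"
  using per_mult[of j "m mod int n" "m div int n"] by simp

lemma rdet_permutes:
  assumes p: "p permutes {0..<n}" and m: "\<And>i. i < n \<Longrightarrow> m i mod int n = int (p i)"
  shows "rdet m = signof p * rdet int"
proof -
  have "rdet m = Determinant.det (Matrix.mat n n (\<lambda>(i, j). Matrix.mat n n (\<lambda>(i, j). b j (int i)) $$ (p i, j)))"
    unfolding rdet_def
  proof (intro arg_cong[of _ _ Determinant.det] eq_matI)
    fix i j assume "i < dim_row (Matrix.mat n n (\<lambda>(i, j). Matrix.mat n n (\<lambda>(i, j). b j (int i)) $$ (p i, j)))"
      "j < dim_col (Matrix.mat n n (\<lambda>(i, j). Matrix.mat n n (\<lambda>(i, j). b j (int i)) $$ (p i, j)))"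
    hence ij: "i < n" "j < n" by auto
    moreover have "p i < n" using permutes_in_image[OF p, of i] ij by simp
    ultimately show "Matrix.mat n n (\<lambda>(i, j). b j (m i)) $$ (i, j) =
      Matrix.mat n n (\<lambda>(i, j). Matrix.mat n n (\<lambda>(i, j). b j (int i)) $$ (p i, j)) $$ (i, j)"
      using per_mod[of j "m i"] m[of i] by simp
  qed auto
  also have "\<dots> = signof p * rdet int" unfolding rdet_def by (rule det_permute_rows[OF _ p]) auto
  finally show ?thesis .
qed

text \<open>Two indices with the same residue give two equal rows.\<close>

lemma rdet_eq_0:
  assumes "\<not> inj_on (\<lambda>i. m i mod int n) {0..<n}"
  shows "rdet m = 0"
proof -
  from assms obtain i i' where i: "i < n" "i' < n" "i \<noteq> i'" "m i mod int n = m i' mod int n"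
    by (auto simp: inj_on_def)
  have eq: "b j (m i) = b j (m i')" if "j < n" for j
    using per_mod[OF that, of "m i"] per_mod[OF that, of "m i'"] i by simp
  show ?thesis unfolding rdet_def
    by (rule det_identical_rows[of _ n i i']) (use i eq in \<open>auto intro!: eq_vecI\<close>)
qed

lemma residues_permutes:
  assumes "inj_on (\<lambda>i. m i mod int n) {0..<n}"
  shows "(\<lambda>i. if i < n then nat (m i mod int n) else i) permutes {0..<n}"
proof -
  define p where "p = (\<lambda>i. if i < n then nat (m i mod int n) else i)"
  have "inj_on p {0..<n}"
    using assms n by (auto simp: inj_on_def p_def nat_eq_iff)
  moreover have "p ` {0..<n} \<subseteq> {0..<n}" using n by (auto simp: p_def nat_less_iff)
  ultimately have "bij_betw p {0..<n} {0..<n}"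
    by (simp add: bij_betw_def endo_inj_surj)
  thus ?thesis unfolding p_def[symmetric]
    by (rule bij_imp_permutes) (auto simp: p_def)
qed

lemma rdet_Suc: "rdet (\<lambda>i. m i + 1) = - rdet m"
proof (cases "inj_on (\<lambda>i. m i mod int n) {0..<n}")
  case True
  define p where "p = (\<lambda>i. if i < n then nat (m i mod int n) else i)"
  have p: "p permutes {0..<n}" using residues_permutes[OF True] by (simp add: p_def)
  \<comment> \<open>\<open>rot k\<close> is a cycle on \<open>k + 1 = n\<close> points, so its sign
    is \<open>(-1) ^ k = -1\<close> for even \<open>n\<close>.\<close>
  obtain k where k: "n = Suc k" using n by (cases n) auto
  have r: "rot k permutes {0..<n}" using rot_permutes k by simp
  have pm: "int (p i) = m i mod int n" if "i < n" for i using that by (simp add: p_def)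
  have "rdet m = signof p * rdet int"
    by (rule rdet_permutes[OF p]) (simp add: pm)
  moreover have "rdet (\<lambda>i. m i + 1) = signof (rot k \<circ> p) * rdet int"
  proof (rule rdet_permutes[OF permutes_compose[OF p r]])
    fix i assume i: "i < n"
    have "(m i + 1) mod int n = (int (p i) + 1) mod int n"
      using pm[OF i] by (simp add: mod_simps)
    \<comment> \<open>The residue \<open>k = n - 1\<close> wraps around to 0.\<close>
    also have "\<dots> = int ((rot k \<circ> p) i)"
      using permutes_in_image[OF p, of i] i
      by (cases "p i = k") (auto simp: rot_def k add.commute)
    finally show "(m i + 1) mod int n = int ((rot k \<circ> p) i)" .
  qed
  moreover have "sign (rot k \<circ> p) = - sign p"
    using permutes_imp_permutation[OF _ p] permutes_imp_permutation[OF _ r] n k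
    by (subst sign_compose) (auto simp: sign_rot)
  ultimately show ?thesis by simp
next
  case False
  \<comment> \<open>A collision of residues survives adding 1, so both determinants are 0.\<close>
  have "\<not> inj_on (\<lambda>i. (m i + 1) mod int n) {0..<n}"
  proof
    assume *: "inj_on (\<lambda>i. (m i + 1) mod int n) {0..<n}"
    have "inj_on (\<lambda>i. m i mod int n) {0..<n}"
    proof (rule inj_onI)
      fix x y assume xy: "x \<in> {0..<n}" "y \<in> {0..<n}" "m x mod int n = m y mod int n"
      hence "(m x + 1) mod int n = (m y + 1) mod int n" by (metis mod_add_left_eq)
      thus "x = y" using * xy by (auto dest: inj_onD)
    qed
    thus False using False by simp
  qed
  thus ?thesis using False by (simp add: rdet_eq_0)
qed

lemma rdet_add: "rdet (\<lambda>i. m i + s) = (if even s then 1 else -1) * rdet m"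
proof (induction s rule: int_induct[of _ 0])
  case base thus ?case by simp
next
  case (step1 s)
  thus ?case using rdet_Suc[of "\<lambda>i. m i + s"] by (auto simp: algebra_simps)
next
  case (step2 s)
  thus ?case using rdet_Suc[of "\<lambda>i. m i + (s - 1)"] by (auto simp: algebra_simps)
qed

text \<open>If the determinant is nonzero, the residues are 0, ..., n - 1 in some order. Twice the
  sum is then \<open>n * (n - 1)\<close> plus a multiple of \<open>2 * n\<close>, and
  \<open>n - 1\<close> is odd.\<close>

lemma rdet_nonzero_sum:
  assumes "rdet m \<noteq> 0"
  obtains t where "odd t" "2 * (\<Sum>i<n. m i) = int n * t"
proof -
  define p where "p = (\<lambda>i. if i < n then nat (m i mod int n) else i)"
  have p: "p permutes {0..<n}" using residues_permutes[of m] rdet_eq_0[of m] assms by (auto simp: p_def)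
  have "(\<Sum>i<n. m i) = (\<Sum>i<n. int (p i) + int n * (m i div int n))"
    by (rule sum.cong) (use n in \<open>auto simp: p_def\<close>)
  also have "\<dots> = int (\<Sum>i<n. p i) + int n * (\<Sum>i<n. m i div int n)"
    by (simp add: sum.distrib sum_distrib_left)
  also have "(\<Sum>i<n. p i) = (\<Sum>i<n. i)"
    using sum.permute[OF p, of "\<lambda>i. i"] by (simp add: lessThan_atLeast0 o_def)
  finally have "2 * (\<Sum>i<n. m i) = int (2 * (\<Sum>i<n. i)) + int n * (2 * (\<Sum>i<n. m i div int n))"
    by (simp add: algebra_simps)
  also have "2 * (\<Sum>i<n. i) = n * (n - 1)"
  proof -
    have "2 * (\<Sum>i<Suc k. i) = Suc k * k" for k by (induction k) auto
    from this[of "n - 1"] show ?thesis using n by simp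
  qed
  finally have "2 * (\<Sum>i<n. m i) = int n * (int n - 1 + 2 * (\<Sum>i<n. m i div int n))"
    using n by (simp add: algebra_simps of_nat_diff)
  moreover have "odd (int n - 1 + 2 * (\<Sum>i<n. m i div int n))" using n by simp
  ultimately show ?thesis using that by blast
qed

end

lemma infsum_finite_sum:
  fixes f :: "'a \<Rightarrow> 'b \<Rightarrow> 'c :: {topological_comm_monoid_add, t2_space}"
  assumes "finite I" "\<And>i. i \<in> I \<Longrightarrow> f i summable_on A"
  shows "(\<Sum>\<^sub>\<infinity>x\<in>A. \<Sum>i\<in>I. f i x) = (\<Sum>i\<in>I. infsum (f i) A)"
proof -
  have "((\<lambda>x. \<Sum>i\<in>I. f i x) has_sum (\<Sum>i\<in>I. infsum (f i) A)) A"
    using assms by (induction I rule: finite_induct) (auto intro!: has_sum_add has_sum_infsum)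
  thus ?thesis by (rule infsumI)
qed

theorem det_theta_space_eq_0:
  assumes n: "n > 0" "even n"
    and H: "\<And>j. j < n \<Longrightarrow> H j \<in> theta_space \<tau> n"
    and v: "(\<Sum>i<n. v i) = 0"
  shows "Determinant.det (Matrix.mat n n (\<lambda>(i, j). H j (v i))) = 0"
proof -
  define c where "c = (\<lambda>m::int. of_real pi * \<i> * \<tau> * (of_int m)\<^sup>2 / of_nat n)"
  have "\<exists>b. \<forall>j. j < n \<longrightarrow> (\<forall>m. b j (m + int n) = b j m) \<and> has_fourier (\<lambda>m. b j m * exp (c m)) (H j)"
  proof (intro choice allI)
    fix j
    show "\<exists>b. j < n \<longrightarrow> (\<forall>m. b (m + int n) = b m) \<and> has_fourier (\<lambda>m. b m * exp (c m)) (H j)"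
    proof (cases "j < n")
      case True
      obtain b where "\<And>m. b (m + int n) = b m" "has_fourier (\<lambda>m. b m * exp (c m)) (H j)"
        using theta_space_coeffs[OF H[OF True] n(1)] unfolding c_def by blast
      thus ?thesis by blast
    qed auto
  qed
  then obtain b where per: "\<And>j m. j < n \<Longrightarrow> b j (m + int n) = b j m"
    and four: "\<And>j. j < n \<Longrightarrow> has_fourier (\<lambda>m. b j m * exp (c m)) (H j)" by blast
  interpret periodic_rows n b by unfold_locales (use n per in auto)
  \<comment> \<open>Frequency vectors are extensional functions, the form in which a finite product
    of series is multiplied out. \<open>f p i\<close> lists the Fourier terms of
    \<open>H (p i)\<close> at \<open>v i\<close>, and \<open>T m\<close> collects all contributions
    of the vector \<open>m\<close>.\<close>
  define A where "A = PiE {0..<n} (\<lambda>_. UNIV :: int set)"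
  define f where "f = (\<lambda>p i m. b (p i) m * exp (c m) * exp (\<i> * of_int m * v i))"
  define E where "E = (\<lambda>m. \<Sum>i=0..<n. c (m i) + \<i> * of_int (m i) * v i)"
  define T where "T = (\<lambda>m. exp (E m) * rdet m)"
  define P where "P = {p. p permutes {0..<n}}"
  have finP: "finite P" unfolding P_def by (rule finite_permutations) simp
  have pl: "p i < n" if "p \<in> P" "i < n" for p i
    using that permutes_in_image[of p "{0..<n}" i] by (auto simp: P_def)
  have abs: "(\<lambda>m. norm (f p i m)) summable_on UNIV" if "p \<in> P" "i < n" for p i
    using has_fourier_abs_summable[OF four[OF pl[OF that]]] by (simp add: f_def)
  have f_sum: "H (p i) (v i) = infsum (f p i) UNIV" if "p \<in> P" "i < n" for p i
    using four[OF pl[OF that]] by (auto simp: f_def has_fourier_def intro!: infsumI[symmetric])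
  \<comment> \<open>The exponentials depend on \<open>m\<close> but not on \<open>p\<close>, so they
    leave the Leibniz sum, and what remains is \<open>rdet m\<close>.\<close>
  have T_eq: "T m = (\<Sum>p\<in>P. signof p * (\<Prod>i=0..<n. f p i (m i)))" for m
  proof -
    have "rdet m = (\<Sum>p\<in>P. signof p * (\<Prod>i=0..<n. b (p i) (m i)))"
      unfolding rdet_def P_def using permutes_in_image
      by (subst det_def') (fastforce intro!: sum.cong prod.cong)+
    moreover have "exp (E m) = (\<Prod>i=0..<n. exp (c (m i)) * exp (\<i> * of_int (m i) * v i))"
      by (simp add: E_def exp_sum flip: exp_add)
    ultimately show ?thesis
      by (simp add: T_def f_def sum_distrib_left prod.distrib mult_ac)
  qed
  have "Determinant.det (Matrix.mat n n (\<lambda>(i, j). H j (v i))) =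
    (\<Sum>p\<in>P. signof p * (\<Prod>i=0..<n. H (p i) (v i)))"
    unfolding P_def using permutes_in_image
    by (subst det_def') (fastforce intro!: sum.cong prod.cong)+
  \<comment> \<open>Each product of \<open>n\<close> absolutely convergent series becomes a single
    series over \<open>A\<close>.\<close>
  also have "\<dots> = (\<Sum>p\<in>P. \<Sum>\<^sub>\<infinity>m\<in>A. signof p * (\<Prod>i=0..<n. f p i (m i)))"
  proof (rule sum.cong)
    fix p assume p: "p \<in> P"
    have "(\<Prod>i=0..<n. H (p i) (v i)) = (\<Prod>i=0..<n. infsum (f p i) UNIV)"
      by (rule prod.cong) (auto simp: f_sum[OF p])
    also have "\<dots> = (\<Sum>\<^sub>\<infinity>m\<in>A. \<Prod>i=0..<n. f p i (m i))" unfolding A_def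
      by (rule infsum_prod_PiE_abs[symmetric]) (use abs[OF p] in auto)
    finally show "signof p * (\<Prod>i=0..<n. H (p i) (v i)) = (\<Sum>\<^sub>\<infinity>m\<in>A. signof p * (\<Prod>i=0..<n. f p i (m i)))"
      by (simp add: infsum_cmult_right')
  qed auto
  also have "\<dots> = infsum T A"
    unfolding T_eq[abs_def]
  proof (rule infsum_finite_sum[OF finP, symmetric])
    fix p assume p: "p \<in> P"
    have "Infinite_Set_Sum.abs_summable_on (\<lambda>m. \<Prod>i=0..<n. f p i (m i)) A" unfolding A_def
      by (rule abs_summable_on_prod_PiE) (use abs[OF p] in \<open>auto simp: abs_summable_equivalent[symmetric]\<close>)
    hence "(\<lambda>m. \<Prod>i=0..<n. f p i (m i)) summable_on A"
      unfolding abs_summable_equivalent[symmetric] by (rule abs_summable_summable)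
    thus "(\<lambda>m. signof p * (\<Prod>i=0..<n. f p i (m i))) summable_on A"
      by (rule summable_on_cmult_right)
  qed
  also have "infsum T A = 0"
  proof -
    \<comment> \<open>Where \<open>rdet m\<close> is nonzero the division is exact. Elsewhere
      integer division still makes \<open>\<phi>\<close> an involution of \<open>A\<close>: lowering
      every entry by \<open>t m\<close> lowers the dividend by \<open>2 * n * t m\<close>, a
      multiple of \<open>n\<close>, and so replaces \<open>t m\<close> by
      \<open>- t m\<close>.\<close>
    define t where "t = (\<lambda>m. 2 * (\<Sum>i<n. m i) div int n)"
    define \<phi> where "\<phi> = (\<lambda>m. restrict (\<lambda>i. m i - t m) {0..<n})"
    have t_\<phi>: "t (\<phi> m) = - t m" for m
    proof -
      have s: "(\<Sum>i<n. \<phi> m i) = (\<Sum>i<n. m i) - int n * t m"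
        by (simp add: \<phi>_def lessThan_atLeast0 sum_subtractf)
      have "t (\<phi> m) = 2 * (\<Sum>i<n. \<phi> m i) div int n"
        by (rule fun_cong[OF t_def])
      also have "2 * (\<Sum>i<n. \<phi> m i) = 2 * (\<Sum>i<n. m i) + int n * (- 2 * t m)"
        unfolding s by (simp add: algebra_simps)
      also have "(2 * (\<Sum>i<n. m i) + int n * (- 2 * t m)) div int n = t m - 2 * t m"
        using n(1) by (subst div_mult_self2) (auto simp: t_def)
      finally show ?thesis by simp
    qed
    have \<phi>\<phi>: "\<phi> (\<phi> m) = m" if "m \<in> A" for m
    proof -
      have "\<phi> (\<phi> m) = restrict (\<lambda>i. \<phi> m i - t (\<phi> m)) {0..<n}"
        by (rule fun_cong[OF \<phi>_def])
      also have "\<dots> = restrict m {0..<n}"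
        unfolding t_\<phi> by (auto simp: \<phi>_def)
      also have "\<dots> = m" using that by (auto simp: A_def PiE_restrict)
      finally show ?thesis .
    qed
    have \<phi>A: "\<phi> m \<in> A" for m by (auto simp: A_def \<phi>_def)
    have T\<phi>: "T (\<phi> m) = - T m" for m
    proof -
      have rd: "rdet (\<phi> m) = (if even (t m) then 1 else -1) * rdet m"
      proof -
        have "rdet (\<phi> m) = rdet (\<lambda>i. m i + (- t m))"
          unfolding rdet_def by (intro arg_cong[of _ _ Determinant.det] eq_matI) (auto simp: \<phi>_def)
        thus ?thesis by (simp only: rdet_add even_minus)
      qed
      show ?thesis
      proof (cases "rdet m = 0")
        case True
        thus ?thesis using rd by (simp add: T_def)
      next
        case False
        then obtain s where s: "odd s" "2 * (\<Sum>i<n. m i) = int n * s"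
          using rdet_nonzero_sum by blast
        have ts: "t m = s" using s n by (simp add: t_def)
        have S: "2 * (\<Sum>i=0..<n. of_int (m i)) = of_nat n * (of_int s :: complex)"
          using arg_cong[OF s(2), of "of_int :: int \<Rightarrow> complex"] by (simp add: lessThan_atLeast0)
        \<comment> \<open>\<open>\<kappa> * (s - 2 * m i)\<close> is the change of the Gaussian
          exponent at the entry \<open>m i\<close>. Summed over \<open>i\<close> it vanishes because
          twice the sum of the \<open>m i\<close> is \<open>n * s\<close>; the linear terms vanish
          because the \<open>v i\<close> add up to 0.\<close>
        define \<kappa> where "\<kappa> = of_real pi * \<i> * \<tau> * of_int s / of_nat n"
        have "c (m i - s) + \<i> * of_int (m i - s) * v i = c (m i) + \<i> * of_int (m i) * v i
          + \<kappa> * (of_int s - 2 * of_int (m i))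
          - \<i> * of_int s * v i" for i
          using n(1) by (simp add: c_def \<kappa>_def field_simps power2_eq_square)
        hence "E (\<phi> m) = (\<Sum>i=0..<n. c (m i) + \<i> * of_int (m i) * v i
          + \<kappa> * (of_int s - 2 * of_int (m i))
          - \<i> * of_int s * v i)"
          unfolding E_def by (intro sum.cong) (auto simp: \<phi>_def ts)
        also have "\<dots> = E m + \<kappa> *
          (of_nat n * of_int s - 2 * (\<Sum>i=0..<n. of_int (m i))) - \<i> * of_int s * (\<Sum>i=0..<n. v i)"
          by (simp add: E_def sum.distrib sum_subtractf sum_distrib_left[symmetric])
        also have "\<dots> = E m" unfolding S using v by (simp add: lessThan_atLeast0)
        finally show ?thesis using rd s(1) ts by (simp add: T_def)
      qed
    qed
    \<comment> \<open>Reindexing by the involution equates the sum with its own negative.\<close>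
    have "infsum T A = (\<Sum>\<^sub>\<infinity>m\<in>A. T (\<phi> m))"
      by (rule infsum_reindex_bij_witness[of _ \<phi> \<phi>]) (auto simp: \<phi>\<phi> \<phi>A)
    also have "\<dots> = - infsum T A" by (simp add: T\<phi> infsum_uminus)
    finally show ?thesis by simp
  qed
  finally show ?thesis .
qed

section \<open>Jacobi theta functions and their zeros\<close>

lemma summable_gaussian:
  fixes a c :: real
  assumes "a > 0"
  shows "summable (\<lambda>n. exp (- a * (real n)\<^sup>2 + c * real n))"
proof (rule summable_comparison_test)
  show "summable (\<lambda>n. exp (-1::real) ^ n)" by (rule summable_geometric) simp
  show "\<exists>N. \<forall>n\<ge>N. norm (exp (- a * (real n)\<^sup>2 + c * real n)) \<le> exp (-1) ^ n"
  proof (intro exI allI impI)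
    \<comment> \<open>From this threshold on, the exponent is at most \<open>- n\<close>, so a
      geometric series dominates.\<close>
    fix n assume "n \<ge> nat \<lceil>(c + 1) / a\<rceil>"
    hence "(c + 1) / a \<le> real n" by linarith
    hence "c + 1 \<le> a * real n" using assms by (simp add: field_simps)
    hence "(c + 1) * real n \<le> (a * real n) * real n" by (rule mult_right_mono) simp
    hence "- a * (real n)\<^sup>2 + c * real n \<le> - real n"
      by (simp add: algebra_simps power2_eq_square)
    thus "norm (exp (- a * (real n)\<^sup>2 + c * real n)) \<le> exp (-1) ^ n"
      by (simp flip: exp_of_nat_mult)
  qed
qed

lemma summable_on_gaussian:
  fixes a c :: real
  assumes a: "a > 0"
  shows "(\<lambda>m::int. exp (- a * (of_int m)\<^sup>2 + c * of_int m)) summable_on UNIV"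
proof -
  define g where "g = (\<lambda>m::int. exp (- a * (of_int m)\<^sup>2 + c * of_int m))"
  have nat: "(\<lambda>n. exp (- a * (real n)\<^sup>2 + d * real n)) summable_on UNIV" for d
    by (rule norm_summable_imp_summable_on) (use summable_gaussian[OF a, of d] in simp)
  have "g summable_on (range int)"
    using nat[of c] by (subst summable_on_reindex) (auto simp: g_def o_def)
  moreover have "g summable_on (range (\<lambda>n. - int n))"
    using nat[of "-c"] by (subst summable_on_reindex) (auto simp: g_def o_def inj_def algebra_simps)
  moreover have "range int \<union> range (\<lambda>n. - int n) = UNIV"
  proof -
    have "m \<in> range int \<union> range (\<lambda>n. - int n)" for m by (cases m rule: int_cases2) auto
    thus ?thesis by blast
  qed
  ultimately have "g summable_on UNIV" using summable_on_union[of g "range int" "range (\<lambda>n. - int n)"] by simp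
  thus ?thesis by (simp add: g_def)
qed

text \<open>This is theta_3 at \<open>w / 2\<close>. Halving the argument makes every integer a
  frequency, so the degree drops to 1; up to exponential factors all four Jacobi theta functions are
  shifts of this one series.\<close>

definition jtheta :: "complex \<Rightarrow> complex \<Rightarrow> complex" where
  "jtheta \<tau> w = (\<Sum>\<^sub>\<infinity>m::int. exp (of_real pi * \<i> * \<tau> * (of_int m)\<^sup>2) * exp (\<i> * of_int m * w))"

lemma has_fourier_jtheta:
  assumes "Im \<tau> > 0"
  shows "has_fourier (\<lambda>m. exp (of_real pi * \<i> * \<tau> * (of_int m)\<^sup>2)) (jtheta \<tau>)"
proof (rule has_fourierI)
  fix w
  have "norm (exp (of_real pi * \<i> * \<tau> * (of_int m)\<^sup>2) * exp (\<i> * of_int m * w)) =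
    exp (- (pi * Im \<tau>) * (of_int m)\<^sup>2 + (- Im w) * of_int m)" for m
    by (simp add: norm_mult power2_eq_square flip: exp_add)
  hence "(\<lambda>m. norm (exp (of_real pi * \<i> * \<tau> * (of_int m)\<^sup>2) * exp (\<i> * of_int m * w))) summable_on UNIV"
    using summable_on_gaussian[of "pi * Im \<tau>" "- Im w"] assms by simp
  thus "(\<lambda>m. exp (of_real pi * \<i> * \<tau> * (of_int m)\<^sup>2) * exp (\<i> * of_int m * w)) summable_on UNIV"
    by (rule abs_summable_summable)
qed (simp add: jtheta_def)

lemma has_fourier_determines:
  assumes "has_fourier a F" "has_fourier a G"
  shows "F = G"
  using assms has_sum_unique unfolding has_fourier_def by blast

text \<open>In \<open>(m + 1)^2 = m^2 + 2 m + 1\<close> the linear term is the effect of the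
  translation by 2 pi tau on the m-th term, and the 1 is the constant factor
  \<open>exp (- \<i> * pi * \<tau>)\<close>.\<close>

lemma jtheta_in_theta_space:
  assumes "Im \<tau> > 0"
  shows "jtheta \<tau> \<in> theta_space \<tau> 1"
proof -
  let ?a = "\<lambda>m::int. exp (of_real pi * \<i> * \<tau> * (of_int m)\<^sup>2)"
  have "has_fourier (\<lambda>m. exp (- \<i> * of_real pi * \<tau>) * ?a (m - (-1)))
      (\<lambda>v. exp (- \<i> * of_real pi * \<tau>) * (exp (\<i> * of_int (-1) * v) * jtheta \<tau> v))"
    by (rule has_fourier_cmult[OF has_fourier_exp_mult[OF has_fourier_jtheta[OF assms]]])
  also have "(\<lambda>m. exp (- \<i> * of_real pi * \<tau>) * ?a (m - (-1))) = (\<lambda>m. ?a m * exp (\<i> * of_int m * (2 * of_real pi * \<tau>)))"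
    by (simp add: algebra_simps power2_eq_square flip: exp_add)
  finally have "(\<lambda>v. exp (- \<i> * of_real pi * \<tau>) * (exp (\<i> * of_int (-1) * v) * jtheta \<tau> v)) =
    (\<lambda>v. jtheta \<tau> (v + 2 * of_real pi * \<tau>))"
    using has_fourier_shift[OF has_fourier_jtheta[OF assms]] by (rule has_fourier_determines)
  hence "jtheta \<tau> (v + 2 * of_real pi * \<tau>) = exp (- \<i> * of_real pi * \<tau>) * (exp (\<i> * of_int (-1) * v) * jtheta \<tau> v)" for v
    by metis
  moreover have "exp (- \<i> * of_real pi * \<tau>) * exp (\<i> * of_int (-1) * v) =
    exp (- \<i> * of_nat 1 * (v + of_real pi * \<tau>))" for v
    by (simp add: algebra_simps flip: exp_add)
  ultimately have "jtheta \<tau> (v + 2 * of_real pi * \<tau>) = exp (- \<i> * of_nat 1 * (v + of_real pi * \<tau>)) * jtheta \<tau> v" for v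
    by (metis mult.assoc)
  thus ?thesis using has_fourier_jtheta[OF assms]
    unfolding theta_space_def fourier_def by blast
qed

text \<open>Euler's expansion of \<open>\<Prod>k. 1 + q\<^bsup>2k+1\<^esup> x\<close>; the functional equation below replaces the
  infinite product.\<close>

definition euler_fps :: "complex \<Rightarrow> complex fps" where
  "euler_fps q = Abs_fps (\<lambda>n. \<Prod>k<n. q ^ (2 * k + 1) / (1 - q ^ (2 * k + 2)))"

context
  fixes q :: complex
  assumes q: "norm q < 1" "q \<noteq> 0"
begin

lemma power_ne_1: "k > 0 \<Longrightarrow> q ^ k \<noteq> 1"
  using power_eq_1_iff[of q k] q by auto

lemma euler_fps_Suc: "fps_nth (euler_fps q) (Suc n) * (1 - q ^ (2 * n + 2)) = q ^ (2 * n + 1) * fps_nth (euler_fps q) n"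
  using power_ne_1[of "2 * n + 2"] by (simp add: euler_fps_def)

text \<open>The ratio of consecutive terms tends to 0 because \<open>q ^ (2 * n + 1)\<close>
  does.\<close>

lemma euler_fps_conv_radius: "fps_conv_radius (euler_fps q) = \<infinity>"
  unfolding fps_conv_radius_def
proof (rule conv_radius_inftyI'')
  fix z
  define e where "e = fps_nth (euler_fps q)"
  have lim: "(\<lambda>n. norm (q ^ (2 * n + 1) / (1 - q ^ (2 * n + 2)) * z)) \<longlonglongrightarrow> norm (0 / (1 - 0) * z)"
    using q by (intro tendsto_intros LIMSEQ_power_zero[THEN LIMSEQ_subseq_LIMSEQ, unfolded o_def, of _ "\<lambda>n. 2 * n + 1"]
      LIMSEQ_power_zero[THEN LIMSEQ_subseq_LIMSEQ, unfolded o_def, of _ "\<lambda>n. 2 * n + 2"])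
      (auto simp: strict_mono_def)
  hence "eventually (\<lambda>n. norm (q ^ (2 * n + 1) / (1 - q ^ (2 * n + 2)) * z) < 1 / 2) sequentially"
    by (intro order_tendstoD[OF lim]) simp
  then obtain N where N: "\<And>n. n \<ge> N \<Longrightarrow> norm (q ^ (2 * n + 1) / (1 - q ^ (2 * n + 2)) * z) < 1 / 2"
    by (auto simp: eventually_sequentially)
  show "summable (\<lambda>n. e n * z ^ n)"
  proof (rule summable_ratio_test[of "1 / 2"])
    fix n assume n: "n \<ge> N"
    define A where "A = q ^ (2 * n + 1) / (1 - q ^ (2 * n + 2)) * z"
    have "norm (e (Suc n) * z ^ Suc n) = norm (A * (e n * z ^ n))"
      by (simp add: e_def euler_fps_def A_def mult_ac)
    also have "\<dots> = norm A * norm (e n * z ^ n)" by (rule norm_mult)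
    also have "\<dots> \<le> 1 / 2 * norm (e n * z ^ n)"
      using N[OF n] by (intro mult_right_mono) (auto simp: A_def)
    finally show "norm (e (Suc n) * z ^ Suc n) \<le> 1 / 2 * norm (e n * z ^ n)" .
  qed simp
qed

text \<open>In the product picture the factor for \<open>k = 0\<close> is split off. The proof
  compares coefficients by means of \<open>euler_fps_Suc\<close>.\<close>

lemma euler_functional_equation:
  "eval_fps (euler_fps q) x = (1 + q * x) * eval_fps (euler_fps q) (q\<^sup>2 * x)"
proof -
  define e where "e = fps_nth (euler_fps q)"
  define E where "E = eval_fps (euler_fps q)"
  have S: "(\<lambda>n. e n * y ^ n) sums E y" for y
    unfolding e_def E_def by (rule sums_eval_fps) (simp add: euler_fps_conv_radius)
  have "(\<lambda>n. e n * x ^ n - e n * (q\<^sup>2 * x) ^ n) sums (E x - E (q\<^sup>2 * x))"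
    by (intro sums_diff S)
  \<comment> \<open>The constant terms cancel, so the difference series starts at index 1.\<close>
  hence "(\<lambda>n. e (Suc n) * x ^ Suc n - e (Suc n) * (q\<^sup>2 * x) ^ Suc n) sums (E x - E (q\<^sup>2 * x))"
    by (subst sums_Suc_iff) simp
  also have "(\<lambda>n. e (Suc n) * x ^ Suc n - e (Suc n) * (q\<^sup>2 * x) ^ Suc n) =
    (\<lambda>n. q * x * (e n * (q\<^sup>2 * x) ^ n))"
  proof
    fix n
    have h: "(q\<^sup>2 * x) ^ k = q ^ (2 * k) * x ^ k" for k
      by (simp add: power_mult_distrib power_mult)
    have "e (Suc n) * x ^ Suc n - e (Suc n) * (q\<^sup>2 * x) ^ Suc n = e (Suc n) * (1 - q ^ (2 * n + 2)) * x ^ Suc n"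
      unfolding h by (simp add: algebra_simps)
    also have "\<dots> = q * x * (e n * (q\<^sup>2 * x) ^ n)"
      unfolding e_def euler_fps_Suc h by simp
    finally show "e (Suc n) * x ^ Suc n - e (Suc n) * (q\<^sup>2 * x) ^ Suc n = q * x * (e n * (q\<^sup>2 * x) ^ n)" .
  qed
  finally have "E x - E (q\<^sup>2 * x) = q * x * E (q\<^sup>2 * x)"
    using S sums_mult sums_unique2 by blast
  thus ?thesis by (simp add: E_def algebra_simps)
qed

text \<open>If no factor vanishes, the functional equation passes a zero at \<open>x\<close> on to
  \<open>q^2 x\<close>, \<open>q^4 x\<close>, ..., and by continuity to 0, where the value is
  1.\<close>

lemma euler_zeroD:
  assumes "eval_fps (euler_fps q) x = 0"
  shows "\<exists>k. q ^ (2 * k + 1) * x = -1"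
proof (rule ccontr)
  assume no: "\<nexists>k. q ^ (2 * k + 1) * x = -1"
  define E where "E = eval_fps (euler_fps q)"
  have E0: "E (q ^ (2 * n) * x) = 0" for n
  proof (induction n)
    case 0 thus ?case using assms by (simp add: E_def)
  next
    case (Suc n)
    have "0 = (1 + q * (q ^ (2 * n) * x)) * E (q\<^sup>2 * (q ^ (2 * n) * x))"
      using euler_functional_equation[of "q ^ (2 * n) * x"] Suc by (simp add: E_def)
    moreover have "1 + q * (q ^ (2 * n) * x) \<noteq> 0"
      using no[unfolded not_ex, rule_format, of n] by (auto simp: add_eq_0_iff mult.assoc)
    ultimately show ?case by (simp add: power2_eq_square mult_ac)
  qed
  have "(\<lambda>n. q ^ (2 * n) * x) \<longlonglongrightarrow> 0 * x"
    using q by (intro tendsto_intros LIMSEQ_power_zero[THEN LIMSEQ_subseq_LIMSEQ, unfolded o_def, of _ "\<lambda>n. 2 * n"])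
      (auto simp: strict_mono_def)
  moreover have "isCont E 0" unfolding E_def by (intro continuous_eval_fps) (simp add: euler_fps_conv_radius)
  ultimately have "(\<lambda>n. E (q ^ (2 * n) * x)) \<longlonglongrightarrow> E 0"
    using isCont_tendsto_compose by fastforce
  hence "E 0 = 0" unfolding E0 by (simp add: LIMSEQ_const_iff)
  thus False by (simp add: E_def eval_fps_at_0 euler_fps_def)
qed

end

text \<open>The triple product up to a constant: the product \<open>P\<close> of Euler's function at
  \<open>exp (\<i> * v)\<close> and at \<open>exp (- \<i> * v)\<close> has degree 1, hence is a
  multiple of \<open>jtheta \<tau>\<close>. So a zero of \<open>jtheta \<tau>\<close> is a zero of
  one of the two Euler factors.\<close>

lemma jtheta_zeroD:
  assumes tau: "Im \<tau> > 0" and zero: "jtheta \<tau> w = 0"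
  obtains j :: int where "odd j" "exp (\<i> * w) = - exp (of_real pi * \<i> * \<tau> * of_int j)"
proof -
  define q where "q = exp (of_real pi * \<i> * \<tau>)"
  have q: "norm q < 1" "q \<noteq> 0" using tau by (auto simp: q_def)
  define E where "E = eval_fps (euler_fps q)"
  define P where "P = (\<lambda>v. E (exp (\<i> * v)) * E (exp (- \<i> * v)))"
  have "fourier P"
    using has_fourier_eval_fps[OF euler_fps_conv_radius[OF q]] has_fourier_reflect[OF has_fourier_eval_fps[OF euler_fps_conv_radius[OF q]]]
    unfolding P_def E_def by (intro fourier_mult) (auto simp: fourier_def)
  moreover have "P (v + 2 * of_real pi * \<tau>) = exp (- \<i> * of_nat 1 * (v + of_real pi * \<tau>)) * P v" for v
  proof -
    define x where "x = exp (\<i> * v)"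
    have x: "x \<noteq> 0" "exp (- \<i> * v) = inverse x" by (auto simp: x_def exp_minus)
    have x': "exp (\<i> * (v + 2 * of_real pi * \<tau>)) = q\<^sup>2 * x"
      by (simp add: x_def q_def algebra_simps power2_eq_square flip: exp_add)
    have x'': "exp (- \<i> * (v + 2 * of_real pi * \<tau>)) = inverse (q\<^sup>2 * x)"
      by (simp add: x_def q_def algebra_simps power2_eq_square flip: exp_add exp_minus)
    have m: "exp (- \<i> * of_nat 1 * (v + of_real pi * \<tau>)) = inverse (q * x)"
      by (simp add: x_def q_def algebra_simps flip: exp_add exp_minus)
    \<comment> \<open>Translation removes the factor \<open>1 + q x\<close> at \<open>x\<close> and
      creates the factor \<open>1 + 1 / (q x)\<close> at \<open>1 / x\<close>; their quotient is the
      multiplier \<open>1 / (q x)\<close>.\<close>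
    have e1: "E x = (1 + q * x) * E (q\<^sup>2 * x)"
      unfolding E_def by (rule euler_functional_equation[OF q])
    have e2: "E (inverse (q\<^sup>2 * x)) = (1 + inverse (q * x)) * E (inverse x)"
      unfolding E_def using euler_functional_equation[OF q, of "inverse (q\<^sup>2 * x)"] q x
      by (simp add: field_simps power2_eq_square)
    have "P (v + 2 * of_real pi * \<tau>) = E (q\<^sup>2 * x) * ((1 + inverse (q * x)) * E (inverse x))"
      by (simp only: P_def x' x'' e2)
    also have "\<dots> = inverse (q * x) * (((1 + q * x) * E (q\<^sup>2 * x)) * E (inverse x))"
      using q x by (simp add: field_simps)
    finally show ?thesis by (simp only: m P_def x_def[symmetric] x(2) e1[symmetric])
  qed
  ultimately have "P \<in> theta_space \<tau> 1" by (simp add: theta_space_def)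
  then obtain b where b: "\<And>m. b (m + int 1) = b m"
    "has_fourier (\<lambda>m. b m * exp (of_real pi * \<i> * \<tau> * (of_int m)\<^sup>2 / of_nat 1)) P"
    using theta_space_coeffs[of P \<tau> 1] by auto
  \<comment> \<open>Coefficients of period 1 are constant, so \<open>jtheta \<tau>\<close> spans the
    space of degree 1.\<close>
  have b0: "b m = b 0" for m
  proof (induction m rule: int_induct[of _ 0])
    case (step1 i) thus ?case using b(1)[of i] by simp
  next
    case (step2 i) thus ?case using b(1)[of "i - 1"] by simp
  qed auto
  have "(\<lambda>m. b m * exp (of_real pi * \<i> * \<tau> * (of_int m)\<^sup>2 / of_nat 1)) =
      (\<lambda>m. b 0 * exp (of_real pi * \<i> * \<tau> * (of_int m)\<^sup>2))"
    by (rule ext, subst b0) simp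
  hence "has_fourier (\<lambda>m. b 0 * exp (of_real pi * \<i> * \<tau> * (of_int m)\<^sup>2)) P"
    using b(2) by simp
  hence P: "P = (\<lambda>v. b 0 * jtheta \<tau> v)"
    using has_fourier_cmult[OF has_fourier_jtheta[OF tau]] by (rule has_fourier_determines)
  have "E (exp (\<i> * w)) = 0 \<or> E (exp (- \<i> * w)) = 0"
    using fun_cong[OF P, of w] zero by (simp add: P_def)
  \<comment> \<open>The factor in \<open>exp (\<i> * w)\<close> yields negative odd exponents, the
    one in \<open>exp (- \<i> * w)\<close> positive ones.\<close>
  thus ?thesis
  proof
    assume "E (exp (\<i> * w)) = 0"
    then obtain k where "q ^ (2 * k + 1) * exp (\<i> * w) = -1"
      using euler_zeroD[OF q] unfolding E_def by blast
    moreover define b where "b = exp (of_real pi * \<i> * \<tau> * of_int (- (2 * int k + 1)))"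
    moreover have "q ^ (2 * k + 1) = inverse b"
      unfolding q_def b_def exp_of_nat_mult[symmetric] exp_minus[symmetric] by (simp add: algebra_simps)
    ultimately have "inverse b * exp (\<i> * w) = -1" "b \<noteq> 0" by simp_all
    hence "exp (\<i> * w) = - exp (of_real pi * \<i> * \<tau> * of_int (- (2 * int k + 1)))"
      unfolding b_def[symmetric] by (simp add: field_simps)
    thus ?thesis by (rule that[rotated]) simp
  next
    assume "E (exp (- \<i> * w)) = 0"
    then obtain k where "q ^ (2 * k + 1) * exp (- \<i> * w) = -1"
      using euler_zeroD[OF q] unfolding E_def by blast
    moreover define b where "b = exp (of_real pi * \<i> * \<tau> * of_int (2 * int k + 1))"
    moreover have "q ^ (2 * k + 1) = b"
      unfolding q_def b_def exp_of_nat_mult[symmetric] by (simp add: algebra_simps)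
    ultimately have "b * inverse (exp (\<i> * w)) = -1" by (simp add: exp_minus)
    hence "exp (\<i> * w) = - exp (of_real pi * \<i> * \<tau> * of_int (2 * int k + 1))"
      unfolding b_def[symmetric] by (simp add: field_simps)
    thus ?thesis by (rule that[rotated]) simp
  qed
qed

lemma fourier_double:
  assumes "fourier F"
  shows "fourier (\<lambda>v. F (2 * v))"
proof -
  obtain a where a: "has_fourier a F" using assms by (auto simp: fourier_def)
  have "has_fourier (\<lambda>m. if even m then a (m div 2) else 0) (\<lambda>v. F (2 * v))"
    unfolding has_fourier_def
  proof
    fix v
    have "((\<lambda>m. a m * exp (\<i> * of_int m * (2 * v))) has_sum F (2 * v)) UNIV"
      using a by (auto simp: has_fourier_def)
    also have "?this \<longleftrightarrow> ((\<lambda>m. (if even m then a (m div 2) else 0) * exp (\<i> * of_int m * v)) has_sum F (2 * v)) {m. even m}"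
      by (rule has_sum_reindex_bij_witness[of _ "\<lambda>m. m div 2" "\<lambda>m. 2 * m"]) (auto simp: mult_ac)
    also have "\<dots> \<longleftrightarrow> ((\<lambda>m. (if even m then a (m div 2) else 0) * exp (\<i> * of_int m * v)) has_sum F (2 * v)) UNIV"
      by (rule has_sum_cong_neutral) auto
    finally show "((\<lambda>m. (if even m then a (m div 2) else 0) * exp (\<i> * of_int m * v)) has_sum F (2 * v)) UNIV" .
  qed
  thus ?thesis by (auto simp: fourier_def)
qed

section \<open>The four theta functions as shifts of one series, and their zeros\<close>

text \<open>The theta function in the numerator of pn, chosen so that pq is a constant multiple of
  the quotient for \<open>p\<close> and \<open>q\<close>, with theta_4 cancelled.\<close>

fun letter_theta :: "complex \<Rightarrow> letter \<Rightarrow> complex \<Rightarrow> complex" where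
  "letter_theta \<tau> letter_s = theta1 \<tau>"
| "letter_theta \<tau> letter_c = theta2 \<tau>"
| "letter_theta \<tau> letter_d = theta3 \<tau>"
| "letter_theta \<tau> letter_n = theta4 \<tau>"

lemma minus_one_powi: "(-1) powi m = exp (\<i> * of_int m * of_real pi)"
proof -
  have "exp (of_int m * (\<i> * of_real pi)) = exp (\<i> * of_real pi) powi m"
    by (rule exp_power_int[symmetric])
  thus ?thesis by (simp add: mult_ac)
qed

lemma theta3_eq: "theta3 \<tau> v = jtheta \<tau> (2 * v)"
  unfolding theta3_def jtheta_def by (rule infsum_cong) (simp add: algebra_simps flip: exp_add)

lemma theta4_eq: "theta4 \<tau> v = jtheta \<tau> (2 * v + of_real pi)"
  unfolding theta4_def jtheta_def minus_one_powi
  by (rule infsum_cong) (simp add: algebra_simps flip: exp_add)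

text \<open>In \<open>(n + 1/2)^2 = n^2 + n + 1/4\<close> the linear term is a shift by pi tau and
  the constant is the prefactor; the half-integral frequencies give \<open>exp (\<i> * v)\<close>.
  For theta_1 the alternating sign adds a shift by pi.\<close>

lemma theta2_eq: "theta2 \<tau> v = exp (of_real pi * \<i> * \<tau> / 4) * (exp (\<i> * v) * jtheta \<tau> (2 * v + of_real pi * \<tau>))"
  unfolding theta2_def jtheta_def infsum_cmult_right'[symmetric]
  by (rule infsum_cong) (simp add: algebra_simps power2_eq_square flip: exp_add)

lemma theta1_eq: "theta1 \<tau> v = - \<i> * exp (of_real pi * \<i> * \<tau> / 4) * (exp (\<i> * v) * jtheta \<tau> (2 * v + of_real pi * \<tau> + of_real pi))"
  unfolding theta1_def jtheta_def infsum_cmult_right'[symmetric] minus_one_powi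
  by (rule infsum_cong) (simp add: algebra_simps power2_eq_square flip: exp_add)

text \<open>Adding 2 pi tau to \<open>v\<close> moves \<open>2 * v\<close> by 4 pi tau, so the law
  of degree 1 applies twice.\<close>

lemma jtheta_double_shift:
  assumes "Im \<tau> > 0"
  shows "jtheta \<tau> (2 * (v + 2 * of_real pi * \<tau>) + d) =
    exp (- 2 * \<i> * d) * exp (- \<i> * of_nat 4 * (v + of_real pi * \<tau>)) * jtheta \<tau> (2 * v + d)"
proof -
  have S: "jtheta \<tau> (w + 2 * of_real pi * \<tau>) = exp (- \<i> * (w + of_real pi * \<tau>)) * jtheta \<tau> w" for w
    using jtheta_in_theta_space[OF assms] by (auto simp: theta_space_def)
  have "2 * (v + 2 * of_real pi * \<tau>) + d = ((2 * v + d) + 2 * of_real pi * \<tau>) + 2 * of_real pi * \<tau>"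
    by (simp add: algebra_simps)
  hence "jtheta \<tau> (2 * (v + 2 * of_real pi * \<tau>) + d) =
    exp (- \<i> * (((2 * v + d) + 2 * of_real pi * \<tau>) + of_real pi * \<tau>)) * exp (- \<i> * ((2 * v + d) + of_real pi * \<tau>)) * jtheta \<tau> (2 * v + d)"
    by (metis S mult.assoc)
  also have "exp (- \<i> * (((2 * v + d) + 2 * of_real pi * \<tau>) + of_real pi * \<tau>)) * exp (- \<i> * ((2 * v + d) + of_real pi * \<tau>)) =
    exp (- 2 * \<i> * d) * exp (- \<i> * of_nat 4 * (v + of_real pi * \<tau>))"
    unfolding exp_add[symmetric] by (rule arg_cong[of _ _ exp]) (simp add: algebra_simps)
  finally show ?thesis .
qed

lemma fourier_jtheta_double:
  assumes "Im \<tau> > 0"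
  shows "fourier (\<lambda>v. jtheta \<tau> (2 * v + d))"
  by (rule fourier_double[of "\<lambda>v. jtheta \<tau> (v + d)"], rule fourier_shift)
     (use has_fourier_jtheta[OF assms] in \<open>auto simp: fourier_def\<close>)

lemma exp_2pi: "exp (2 * \<i> * of_real pi) = 1" "exp (- (2 * \<i> * of_real pi)) = 1"
  using exp_two_pi_i by (auto simp: exp_minus mult_ac)

text \<open>Covers theta_3 with \<open>d = 0\<close> and theta_4 with \<open>d = pi\<close>.\<close>

lemma jtheta_theta_space_0:
  assumes "Im \<tau> > 0" and d: "exp (- 2 * \<i> * d) = 1"
  shows "(\<lambda>v. jtheta \<tau> (2 * v + d)) \<in> theta_space \<tau> 4"
  using fourier_jtheta_double[OF assms(1)] jtheta_double_shift[OF assms(1), of _ d]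
  unfolding theta_space_def d by simp

text \<open>Covers theta_2 and theta_1: the factor that \<open>exp (\<i> * v)\<close> gains under
  translation compensates \<open>exp (- 2 * \<i> * d)\<close> when \<open>d\<close> is pi tau or pi
  tau + pi.\<close>

lemma jtheta_theta_space_1:
  assumes "Im \<tau> > 0" and d: "exp (2 * \<i> * of_real pi * \<tau>) * exp (- 2 * \<i> * d) = 1"
  shows "(\<lambda>v. exp (\<i> * v) * jtheta \<tau> (2 * v + d)) \<in> theta_space \<tau> 4"
proof -
  have "fourier (\<lambda>v. exp (\<i> * v))"
    using has_fourier_eval_fps[of fps_X] by (auto simp: fourier_def)
  hence "fourier (\<lambda>v. exp (\<i> * v) * jtheta \<tau> (2 * v + d))"
    by (intro fourier_mult fourier_jtheta_double assms)
  moreover have "exp (\<i> * (v + 2 * of_real pi * \<tau>)) * jtheta \<tau> (2 * (v + 2 * of_real pi * \<tau>) + d) =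
    exp (- \<i> * of_nat 4 * (v + of_real pi * \<tau>)) * (exp (\<i> * v) * jtheta \<tau> (2 * v + d))" for v
  proof -
    have "exp (\<i> * (v + 2 * of_real pi * \<tau>)) = exp (\<i> * v) * exp (2 * \<i> * of_real pi * \<tau>)"
      by (simp add: algebra_simps flip: exp_add)
    hence "exp (\<i> * (v + 2 * of_real pi * \<tau>)) * jtheta \<tau> (2 * (v + 2 * of_real pi * \<tau>) + d) =
      (exp (2 * \<i> * of_real pi * \<tau>) * exp (- 2 * \<i> * d)) *
      (exp (- \<i> * of_nat 4 * (v + of_real pi * \<tau>)) * (exp (\<i> * v) * jtheta \<tau> (2 * v + d)))"
      unfolding jtheta_double_shift[OF assms(1)] by (simp only: mult_ac)
    thus ?thesis unfolding d by simp
  qed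
  ultimately show ?thesis by (simp add: theta_space_def)
qed

lemma letter_theta_in_theta_space:
  assumes "Im \<tau> > 0"
  shows "letter_theta \<tau> p \<in> theta_space \<tau> 4"
proof (cases p)
  case letter_s
  have "exp (2 * \<i> * of_real pi * \<tau>) * exp (- 2 * \<i> * (of_real pi * \<tau> + of_real pi)) = exp (- (2 * \<i> * of_real pi))"
    unfolding exp_add[symmetric] by (rule arg_cong[of _ _ exp]) (simp add: algebra_simps)
  also have "\<dots> = 1" by (rule exp_2pi)
  finally show ?thesis
    using theta_space_cmult[OF jtheta_theta_space_1[OF assms], of "of_real pi * \<tau> + of_real pi" "- \<i> * exp (of_real pi * \<i> * \<tau> / 4)"]
    by (simp add: letter_s theta1_eq[abs_def] add.assoc)
next
  case letter_c
  have "exp (2 * \<i> * of_real pi * \<tau>) * exp (- 2 * \<i> * (of_real pi * \<tau>)) = 1"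
    unfolding exp_add[symmetric] by simp
  thus ?thesis
    using theta_space_cmult[OF jtheta_theta_space_1[OF assms, of "of_real pi * \<tau>"]]
    by (simp add: letter_c theta2_eq[abs_def])
next
  case letter_d
  thus ?thesis using jtheta_theta_space_0[OF assms, of 0] by (simp add: theta3_eq[abs_def])
next
  case letter_n
  thus ?thesis using jtheta_theta_space_0[OF assms, of "of_real pi"] exp_2pi
    by (simp add: theta4_eq[abs_def])
qed

text \<open>Obtained from \<open>jtheta_zeroD\<close> by undoing the shifts. The sign and the parity
  of \<open>j\<close> form a signature that separates the letters: s is (+, even), c is (-, even), d
  is (-, odd), n is (+, odd).\<close>

lemma letter_theta_zeroD:
  assumes tau: "Im \<tau> > 0" and zero: "letter_theta \<tau> p v = 0"
  shows "\<exists>j :: int. (odd j \<longleftrightarrow> p \<in> {letter_d, letter_n}) \<and>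
    exp (2 * \<i> * v) = (if p \<in> {letter_s, letter_n} then 1 else -1) * exp (of_real pi * \<i> * \<tau> * of_int j)"
proof -
  have A: ?thesis if z: "jtheta \<tau> (2 * v + d) = 0" and ex: "exp (- \<i> * d) = s" and sg:
    "(if p \<in> {letter_s, letter_n} then 1 else -1) = - s" and p: "p \<in> {letter_d, letter_n}" for d s
  proof -
    obtain j where j: "odd j" "exp (\<i> * (2 * v + d)) = - exp (of_real pi * \<i> * \<tau> * of_int j)"
      using jtheta_zeroD[OF tau z] .
    have "exp (2 * \<i> * v) = exp (- \<i> * d) * exp (\<i> * (2 * v + d))"
      by (simp add: algebra_simps flip: exp_add)
    hence "exp (2 * \<i> * v) = (- s) * exp (of_real pi * \<i> * \<tau> * of_int j)"
      using ex j by simp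
    thus ?thesis using p j(1) unfolding sg by blast
  qed
  \<comment> \<open>The additional shift by pi tau turns the odd exponent \<open>j\<close> into the
    even exponent \<open>j - 1\<close>.\<close>
  have B: ?thesis if z: "jtheta \<tau> (2 * v + (of_real pi * \<tau> + d)) = 0" and ex: "exp (- \<i> * d) = s" and sg:
    "(if p \<in> {letter_s, letter_n} then 1 else -1) = - s" and p: "p \<in> {letter_s, letter_c}" for d s
  proof -
    obtain j where j: "odd j" "exp (\<i> * (2 * v + (of_real pi * \<tau> + d))) = - exp (of_real pi * \<i> * \<tau> * of_int j)"
      using jtheta_zeroD[OF tau z] .
    have "exp (2 * \<i> * v) = exp (- \<i> * d) * (exp (\<i> * (2 * v + (of_real pi * \<tau> + d))) * exp (- \<i> * of_real pi * \<tau>))"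
      by (simp add: algebra_simps flip: exp_add)
    also have "exp (\<i> * (2 * v + (of_real pi * \<tau> + d))) * exp (- \<i> * of_real pi * \<tau>) =
      - exp (of_real pi * \<i> * \<tau> * of_int (j - 1))"
      unfolding j(2) by (simp add: algebra_simps flip: exp_add)
    finally have "exp (2 * \<i> * v) = (- s) * exp (of_real pi * \<i> * \<tau> * of_int (j - 1))"
      using ex j by simp
    moreover have "even (j - 1)" "\<not> p \<in> {letter_d, letter_n}" using j p by auto
    ultimately show ?thesis unfolding sg by blast
  qed
  have e: "exp (- (\<i> * of_real pi)) = -1" by (simp add: exp_minus)
  show ?thesis
  proof (cases p)
    case letter_s
    thus ?thesis using zero by (intro B[of "of_real pi" "-1"]) (auto simp: theta1_eq add.assoc e)
  next
    case letter_c
    thus ?thesis using zero by (intro B[of 0 1]) (auto simp: theta2_eq)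
  next
    case letter_d
    thus ?thesis using zero by (intro A[of 0 1]) (auto simp: theta3_eq)
  next
    case letter_n
    thus ?thesis using zero by (intro A[of "of_real pi" "-1"]) (auto simp: theta4_eq e)
  qed
qed

text \<open>The modulus of the exponential is \<open>exp (- pi * Im \<tau> * j)\<close>, which is
  injective in \<open>j\<close>.\<close>

lemma nome_power_inj:
  assumes "Im \<tau> > 0" "norm (s * exp (of_real pi * \<i> * \<tau> * of_int i)) = norm (s' * exp (of_real pi * \<i> * \<tau> * of_int j))"
    "norm s = 1" "norm s' = 1"
  shows "i = j"
  using assms by (auto simp: norm_mult)

text \<open>Both zeros describe the same number \<open>exp (2 * \<i> * v)\<close>. Its modulus fixes
  \<open>j\<close>, then the sign is fixed too, and the signature belongs to one letter
  only.\<close>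

lemma letter_theta_no_common_zero:
  assumes tau: "Im \<tau> > 0" and "letter_theta \<tau> p v = 0" "letter_theta \<tau> p' v = 0"
  shows "p = p'"
proof -
  define s :: "letter \<Rightarrow> complex" where "s = (\<lambda>p. if p \<in> {letter_s, letter_n} then 1 else -1)"
  obtain j where j: "odd j \<longleftrightarrow> p \<in> {letter_d, letter_n}"
    "exp (2 * \<i> * v) = s p * exp (of_real pi * \<i> * \<tau> * of_int j)"
    using letter_theta_zeroD[OF tau assms(2)] unfolding s_def by blast
  obtain j' where j': "odd j' \<longleftrightarrow> p' \<in> {letter_d, letter_n}"
    "exp (2 * \<i> * v) = s p' * exp (of_real pi * \<i> * \<tau> * of_int j')"
    using letter_theta_zeroD[OF tau assms(3)] unfolding s_def by blast
  have eq: "s p * exp (of_real pi * \<i> * \<tau> * of_int j) = s p' * exp (of_real pi * \<i> * \<tau> * of_int j')"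
    using j j' by simp
  have "j = j'"
    by (rule nome_power_inj[OF tau arg_cong[OF eq, of norm]]) (auto simp: s_def)
  hence "s p = s p'" using eq by simp
  thus ?thesis using j(1) j'(1) \<open>j = j'\<close> by (cases p; cases p') (auto simp: s_def)
qed

text \<open>At 0 the exponential is 1, which forces \<open>j = 0\<close> and sign +, the signature
  of \<open>letter_s\<close>.\<close>

lemma letter_theta_0_nonzero:
  assumes tau: "Im \<tau> > 0" and p: "p \<noteq> letter_s"
  shows "letter_theta \<tau> p 0 \<noteq> 0"
proof
  assume "letter_theta \<tau> p 0 = 0"
  define s :: "letter \<Rightarrow> complex" where "s = (\<lambda>p. if p \<in> {letter_s, letter_n} then 1 else -1)"
  obtain j where j: "odd j \<longleftrightarrow> p \<in> {letter_d, letter_n}"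
    "exp (2 * \<i> * 0) = s p * exp (of_real pi * \<i> * \<tau> * of_int j)"
    using letter_theta_zeroD[OF tau \<open>letter_theta \<tau> p 0 = 0\<close>] unfolding s_def by blast
  have eq: "s p * exp (of_real pi * \<i> * \<tau> * of_int j) = 1 * exp (of_real pi * \<i> * \<tau> * of_int 0)"
    using j by simp
  have "j = 0"
    by (rule nome_power_inj[OF tau arg_cong[OF eq, of norm]]) (auto simp: s_def)
  thus False using eq j(1) p by (cases p) (auto simp: s_def)
qed

section \<open>Jacobi elliptic functions as quotients of theta functions\<close>

definition jarg :: "complex \<Rightarrow> complex \<Rightarrow> complex" where
  "jarg \<tau> u = of_real pi * u / (2 * jacobi_K \<tau>)"

fun jcoeff :: "complex \<Rightarrow> letter \<Rightarrow> complex" where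
  "jcoeff \<tau> letter_s = theta3 \<tau> 0 / theta2 \<tau> 0"
| "jcoeff \<tau> letter_c = theta4 \<tau> 0 / theta2 \<tau> 0"
| "jcoeff \<tau> letter_d = theta4 \<tau> 0 / theta3 \<tau> 0"
| "jcoeff \<tau> letter_n = 1"

context
  fixes \<tau> :: complex
  assumes tau: "Im \<tau> > 0"
begin

lemma theta_constants_nonzero: "theta2 \<tau> 0 \<noteq> 0" "theta3 \<tau> 0 \<noteq> 0" "theta4 \<tau> 0 \<noteq> 0"
  using letter_theta_0_nonzero[OF tau, of letter_c] letter_theta_0_nonzero[OF tau, of letter_d]
    letter_theta_0_nonzero[OF tau, of letter_n] by auto

lemma jacobi_K_nonzero: "jacobi_K \<tau> \<noteq> 0"
  using theta_constants_nonzero by (simp add: jacobi_K_def)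

lemma jcoeff_nonzero: "jcoeff \<tau> p \<noteq> 0"
  using theta_constants_nonzero by (cases p) auto

lemma letter_theta_holomorphic: "letter_theta \<tau> p holomorphic_on A"
  using letter_theta_in_theta_space[OF tau] theta_space_fourier fourier_holomorphic by blast

lemma letter_theta_jarg_holomorphic: "(\<lambda>u. letter_theta \<tau> p (jarg \<tau> u)) holomorphic_on A"
  unfolding jarg_def
  by (intro holomorphic_on_compose_gen[OF _ letter_theta_holomorphic[of p UNIV], unfolded o_def] holomorphic_intros)
     (auto simp: jacobi_K_nonzero)

lemma letter_theta_nonzero_ex: "\<exists>v. letter_theta \<tau> p v \<noteq> 0"
proof (cases "p = letter_s")
  case True
  \<comment> \<open>At pi / 2 the exponential is -1. Its modulus would force \<open>j = 0\<close>,
    and then the sign + required by \<open>letter_s\<close> is violated.\<close>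
  have "letter_theta \<tau> letter_s (of_real pi / 2) \<noteq> 0"
  proof
    assume "letter_theta \<tau> letter_s (of_real pi / 2) = 0"
    then obtain j :: int where j: "exp (2 * \<i> * (of_real pi / 2)) = 1 * exp (of_real pi * \<i> * \<tau> * of_int j)"
      using letter_theta_zeroD[OF tau, of letter_s "of_real pi / 2"] by auto
    hence eq: "-1 * exp (of_real pi * \<i> * \<tau> * of_int 0) = 1 * exp (of_real pi * \<i> * \<tau> * of_int j)"
      by simp
    have "0 = j" by (rule nome_power_inj[OF tau arg_cong[OF eq, of norm]]) auto
    thus False using eq by simp
  qed
  thus ?thesis using True by blast
next
  case False
  thus ?thesis using letter_theta_0_nonzero[OF tau] by blast
qed

text \<open>The zeros of an entire function that is not identically 0 are isolated.\<close>

lemma eventually_letter_theta_nonzero: "eventually (\<lambda>w. letter_theta \<tau> p (jarg \<tau> w) \<noteq> 0) (at u)"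
proof -
  obtain v where v: "letter_theta \<tau> p v \<noteq> 0" using letter_theta_nonzero_ex by blast
  have "jarg \<tau> (2 * jacobi_K \<tau> * v / of_real pi) = v"
    by (simp add: jarg_def jacobi_K_nonzero)
  hence "letter_theta \<tau> p (jarg \<tau> (2 * jacobi_K \<tau> * v / of_real pi)) \<noteq> 0" using v by simp
  from non_zero_neighbour_alt[OF letter_theta_jarg_holomorphic[of p UNIV] open_UNIV connected_UNIV UNIV_I UNIV_I this, of u]
  show ?thesis by simp
qed

lemma letter_theta_jarg_isCont: "isCont (\<lambda>u. letter_theta \<tau> p (jarg \<tau> u)) u"
  using holomorphic_on_imp_continuous_on[OF letter_theta_jarg_holomorphic[of p UNIV]]
  by (simp add: continuous_on_eq_continuous_at)

lemma jacobi_pn_eq: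
  assumes "letter_theta \<tau> letter_n (jarg \<tau> u) \<noteq> 0"
  shows "jacobi_pn \<tau> p u = jcoeff \<tau> p * (letter_theta \<tau> p (jarg \<tau> u) / letter_theta \<tau> letter_n (jarg \<tau> u))"
  using assms by (cases p) (auto simp: jarg_def)

text \<open>In a punctured neighbourhood theta_4 is nonzero and cancels. The right-hand side is
  continuous at \<open>u\<close>, so it is the limit chosen by \<open>remove_sings\<close>, even if
  theta_4 vanishes at \<open>u\<close> itself.\<close>

lemma jacobi_eq:
  assumes "letter_theta \<tau> q (jarg \<tau> u) \<noteq> 0"
  shows "jacobi \<tau> p q u =
    jcoeff \<tau> p / jcoeff \<tau> q * (letter_theta \<tau> p (jarg \<tau> u) / letter_theta \<tau> q (jarg \<tau> u))"
  unfolding jacobi_def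
proof (rule remove_sings_eqI)
  have "eventually (\<lambda>u. jacobi_pn \<tau> p u / jacobi_pn \<tau> q u =
     jcoeff \<tau> p / jcoeff \<tau> q * (letter_theta \<tau> p (jarg \<tau> u) / letter_theta \<tau> q (jarg \<tau> u))) (at u)"
    using eventually_letter_theta_nonzero[of letter_n] by eventually_elim (simp add: jacobi_pn_eq)
  moreover have "((\<lambda>u. jcoeff \<tau> p / jcoeff \<tau> q * (letter_theta \<tau> p (jarg \<tau> u) / letter_theta \<tau> q (jarg \<tau> u))) \<longlongrightarrow>
     jcoeff \<tau> p / jcoeff \<tau> q * (letter_theta \<tau> p (jarg \<tau> u) / letter_theta \<tau> q (jarg \<tau> u))) (at u)"
    using assms letter_theta_jarg_isCont by (intro tendsto_intros) (auto simp: isCont_def)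
  ultimately show "((\<lambda>u. jacobi_pn \<tau> p u / jacobi_pn \<tau> q u) \<longlongrightarrow>
     jcoeff \<tau> p / jcoeff \<tau> q * (letter_theta \<tau> p (jarg \<tau> u) / letter_theta \<tau> q (jarg \<tau> u))) (at u)"
    by (subst tendsto_cong)
qed

text \<open>The numerator cannot vanish together with the denominator, so nothing cancels. This
  converts the absence of poles into the nonvanishing of theta functions.\<close>

lemma jacobi_is_pole:
  assumes "p \<noteq> q" and zero: "letter_theta \<tau> q (jarg \<tau> u) = 0"
  shows "is_pole (jacobi \<tau> p q) u"
proof -
  have "letter_theta \<tau> p (jarg \<tau> u) \<noteq> 0"
    using letter_theta_no_common_zero[OF tau _ zero] assms(1) by blast
  hence nz: "jcoeff \<tau> p / jcoeff \<tau> q * letter_theta \<tau> p (jarg \<tau> u) \<noteq> 0" by (simp add: jcoeff_nonzero)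
  have "filterlim (\<lambda>u. letter_theta \<tau> q (jarg \<tau> u)) (at 0) (at u)"
    using letter_theta_jarg_isCont[of u q] eventually_letter_theta_nonzero[of q u] zero
    by (simp add: filterlim_at isCont_def)
  hence "is_pole (\<lambda>u. (jcoeff \<tau> p / jcoeff \<tau> q * letter_theta \<tau> p (jarg \<tau> u)) / letter_theta \<tau> q (jarg \<tau> u)) u"
    using letter_theta_jarg_isCont nz by (intro is_pole_divide continuous_intros)
  also have "?this \<longleftrightarrow> is_pole (jacobi \<tau> p q) u"
  proof (rule is_pole_cong)
    show "\<forall>\<^sub>F w in at u. (jcoeff \<tau> p / jcoeff \<tau> q * letter_theta \<tau> p (jarg \<tau> w)) / letter_theta \<tau> q (jarg \<tau> w) = jacobi \<tau> p q w"
      using eventually_letter_theta_nonzero[of q] by eventually_elim (simp add: jacobi_eq)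
  qed auto
  finally show ?thesis .
qed

text \<open>Each differentiation raises the power in the denominator by one and the degree of the
  numerator by 4. The degree thus stays 4 times the power, the balance under which the quotient rule
  produces a Wronskian.\<close>

lemma jacobi_higher_deriv:
  "\<exists>H \<in> theta_space \<tau> (4 * (b + 1)). \<forall>u. letter_theta \<tau> q (jarg \<tau> u) \<noteq> 0 \<longrightarrow>
     (deriv ^^ b) (jacobi \<tau> p q) u = H (jarg \<tau> u) / letter_theta \<tau> q (jarg \<tau> u) ^ (b + 1)"
proof (induction b)
  case 0
  have "(\<lambda>v. jcoeff \<tau> p / jcoeff \<tau> q * letter_theta \<tau> p v) \<in> theta_space \<tau> (4 * (0 + 1))"
    unfolding add_0 mult_1_right by (rule theta_space_cmult[OF letter_theta_in_theta_space[OF tau]])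
  thus ?case by (rule bexI[rotated]) (simp add: jacobi_eq)
next
  case (Suc b)
  define \<theta> where "\<theta> = letter_theta \<tau> q"
  define k where "k = of_real pi / (2 * jacobi_K \<tau>)"
  obtain H where H: "H \<in> theta_space \<tau> (4 * (b + 1))"
    "\<And>u. \<theta> (jarg \<tau> u) \<noteq> 0 \<Longrightarrow> (deriv ^^ b) (jacobi \<tau> p q) u = H (jarg \<tau> u) / \<theta> (jarg \<tau> u) ^ (b + 1)"
    using Suc by (auto simp: \<theta>_def)
  have \<theta>: "\<theta> \<in> theta_space \<tau> 4" unfolding \<theta>_def by (rule letter_theta_in_theta_space[OF tau])
  \<comment> \<open>\<open>k\<close> is the derivative of \<open>jarg \<tau>\<close>. The Wronskian
    for the degrees \<open>4 * (b + 1)\<close> and 4 is 4 times the numerator in the quotient rule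
    after cancelling \<open>\<theta> ^ b\<close>, hence the division by 4.\<close>
  define H' where "H' = (\<lambda>v. k / 4 * (of_nat 4 * (deriv H v * \<theta> v) - of_nat (4 * (b + 1)) * (H v * deriv \<theta> v)))"
  have "H' \<in> theta_space \<tau> (4 * (b + 1) + 4)"
    unfolding H'_def by (intro theta_space_cmult theta_space_wronskian H \<theta>)
  hence "H' \<in> theta_space \<tau> (4 * (Suc b + 1))" by (simp add: algebra_simps)
  moreover have "(deriv ^^ Suc b) (jacobi \<tau> p q) u = H' (jarg \<tau> u) / \<theta> (jarg \<tau> u) ^ (Suc b + 1)"
    if nz: "\<theta> (jarg \<tau> u) \<noteq> 0" for u
  proof -
    have DH: "(H has_field_derivative deriv H w) (at w)" for w
      using fourier_holomorphic[OF theta_space_fourier[OF H(1)]] by (intro holomorphic_derivI[of _ UNIV]) auto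
    have D\<theta>: "(\<theta> has_field_derivative deriv \<theta> w) (at w)" for w
      using fourier_holomorphic[OF theta_space_fourier[OF \<theta>]] by (intro holomorphic_derivI[of _ UNIV]) auto
    have Dj: "(jarg \<tau> has_field_derivative k) (at u)"
      unfolding jarg_def[abs_def] k_def by (auto intro!: derivative_eq_intros simp: jacobi_K_nonzero)
    \<comment> \<open>The formula can be differentiated because it holds in a whole neighbourhood of
      \<open>u\<close>, where \<open>\<theta>\<close> remains nonzero.\<close>
    have ev: "eventually (\<lambda>w. (deriv ^^ b) (jacobi \<tau> p q) w = H (jarg \<tau> w) / \<theta> (jarg \<tau> w) ^ (b + 1)) (nhds u)"
    proof (rule eventually_mono)
      show "eventually (\<lambda>w. \<theta> (jarg \<tau> w) \<noteq> 0) (nhds u)"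
        using eventually_letter_theta_nonzero[of q u] nz unfolding \<theta>_def
        by (simp add: eventually_nhds_conv_at)
    qed (rule H)
    have "(deriv ^^ Suc b) (jacobi \<tau> p q) u = deriv (\<lambda>w. H (jarg \<tau> w) / \<theta> (jarg \<tau> w) ^ (b + 1)) u"
      using deriv_cong_ev[OF ev] by simp
    also have "\<dots> = ((deriv H (jarg \<tau> u) * k) * \<theta> (jarg \<tau> u) ^ (b + 1) -
        H (jarg \<tau> u) * (of_nat (b + 1) * (deriv \<theta> (jarg \<tau> u) * k) * \<theta> (jarg \<tau> u) ^ b)) / (\<theta> (jarg \<tau> u) ^ (b + 1) * \<theta> (jarg \<tau> u) ^ (b + 1))"
    proof (rule DERIV_imp_deriv, rule DERIV_divide)
      show "((\<lambda>w. H (jarg \<tau> w)) has_field_derivative deriv H (jarg \<tau> u) * k) (at u)"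
        by (rule DERIV_chain2[OF DH Dj])
      show "((\<lambda>w. \<theta> (jarg \<tau> w) ^ (b + 1)) has_field_derivative of_nat (b + 1) * (deriv \<theta> (jarg \<tau> u) * k) * \<theta> (jarg \<tau> u) ^ b) (at u)"
        using DERIV_power[OF DERIV_chain2[OF D\<theta> Dj], of "b + 1"] by (simp add: mult_ac)
    qed (use nz in simp)
    also have "\<dots> = H' (jarg \<tau> u) / \<theta> (jarg \<tau> u) ^ (Suc b + 1)"
      using nz unfolding H'_def by (simp add: field_simps)
    finally show ?thesis .
  qed
  ultimately show ?case unfolding \<theta>_def by blast
qed

end

section \<open>Clearing denominators with the prescribed pole orders\<close>

lemma le_last_if_sorted:
  fixes xs :: "'a :: linorder list"
  assumes "sorted_wrt (<) xs" "x \<in> set xs"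
  shows "x \<le> last xs"
  using assms by (induction xs) (auto intro: less_imp_le)

text \<open>Makes the exponents in the weight natural numbers: dividing a maximum by 4 loses
  nothing, and an empty set gives exponent 0.\<close>

lemma Max_or_zero_multiple:
  assumes "finite A" "\<And>x. x \<in> A \<Longrightarrow> 4 dvd x \<and> x \<ge> 0"
  shows "Max_or_zero A = 4 * int (nat (Max_or_zero A) div 4)"
    and "x \<in> A \<Longrightarrow> x \<le> Max_or_zero A"
proof -
  have *: "4 dvd Max_or_zero A \<and> Max_or_zero A \<ge> 0"
    using assms Max_in[OF assms(1)] by (auto simp: Max_or_zero_def)
  thus "Max_or_zero A = 4 * int (nat (Max_or_zero A) div 4)"
    by (auto simp: zdiv_int)
  show "x \<in> A \<Longrightarrow> x \<le> Max_or_zero A" using assms by (auto simp: Max_or_zero_def)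
qed

abbreviation (input) letters :: "letter set" where
  "letters \<equiv> {letter_s, letter_c, letter_d, letter_n}"

definition theta_weight :: "complex \<Rightarrow> (letter \<Rightarrow> nat) \<Rightarrow> complex \<Rightarrow> complex" where
  "theta_weight \<tau> M v = (\<Prod>p\<in>letters. letter_theta \<tau> p v ^ M p)"

text \<open>\<open>G\<close> keeps the identity away from the poles, where values are mere
  conventions. All numerators share the degree of the weight, so such functions are closed under
  linear combinations.\<close>

definition theta_quotient :: "complex \<Rightarrow> (letter \<Rightarrow> nat) \<Rightarrow> complex set \<Rightarrow> (complex \<Rightarrow> complex) \<Rightarrow> bool" where
  "theta_quotient \<tau> M G h \<longleftrightarrow> (\<exists>H \<in> theta_space \<tau> (\<Sum>p\<in>letters. M p * 4).
     \<forall>u\<in>G. h u * theta_weight \<tau> M (jarg \<tau> u) = H (jarg \<tau> u))"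

lemma theta_quotient_add:
  assumes "theta_quotient \<tau> M G g" "theta_quotient \<tau> M G h"
  shows "theta_quotient \<tau> M G (\<lambda>u. g u + h u)"
proof -
  obtain A B where "A \<in> theta_space \<tau> (\<Sum>p\<in>letters. M p * 4)" "B \<in> theta_space \<tau> (\<Sum>p\<in>letters. M p * 4)"
    "\<forall>u\<in>G. g u * theta_weight \<tau> M (jarg \<tau> u) = A (jarg \<tau> u)"
    "\<forall>u\<in>G. h u * theta_weight \<tau> M (jarg \<tau> u) = B (jarg \<tau> u)"
    using assms unfolding theta_quotient_def by blast
  thus ?thesis unfolding theta_quotient_def
    by (intro bexI[of _ "\<lambda>v. A v + B v"] theta_space_add) (auto simp: ring_distribs)
qed

lemma theta_quotient_cmult:
  assumes "theta_quotient \<tau> M G g"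
  shows "theta_quotient \<tau> M G (\<lambda>u. c * g u)"
proof -
  obtain A where "A \<in> theta_space \<tau> (\<Sum>p\<in>letters. M p * 4)"
    "\<forall>u\<in>G. g u * theta_weight \<tau> M (jarg \<tau> u) = A (jarg \<tau> u)"
    using assms unfolding theta_quotient_def by blast
  thus ?thesis unfolding theta_quotient_def
    by (intro bexI[of _ "\<lambda>v. c * A v"] theta_space_cmult) auto
qed

lemma theta_quotient_sum:
  assumes "finite I" "\<And>i. i \<in> I \<Longrightarrow> theta_quotient \<tau> M G (h i)"
  shows "theta_quotient \<tau> M G (\<lambda>u. \<Sum>i\<in>I. h i u)"
  using assms
proof (induction I rule: finite_induct)
  case empty
  show ?case unfolding theta_quotient_def by (auto intro: bexI[OF _ theta_space_0])
qed (auto intro: theta_quotient_add)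

context
  fixes \<tau> :: complex
  assumes tau: "Im \<tau> > 0"
begin

text \<open>The numerator is the weight itself. This is the case of derivative order -1.\<close>

lemma theta_quotient_const: "theta_quotient \<tau> M G (\<lambda>u. 1)"
proof -
  have "theta_weight \<tau> M \<in> theta_space \<tau> (\<Sum>p\<in>letters. M p * 4)"
    unfolding theta_weight_def[abs_def]
    by (intro theta_space_prod theta_space_power letter_theta_in_theta_space[OF tau]) simp
  thus ?thesis unfolding theta_quotient_def by (intro bexI[of _ "theta_weight \<tau> M"]) simp_all
qed

text \<open>If only one letter contributes to the denominator, the factors of the weight for the
  other letters move into the numerator.\<close>

lemma theta_quotient_single:
  assumes H: "H \<in> theta_space \<tau> (M p * 4)"
    and h: "\<And>u. u \<in> G \<Longrightarrow> h u * letter_theta \<tau> p (jarg \<tau> u) ^ M p = H (jarg \<tau> u)"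
  shows "theta_quotient \<tau> M G h"
proof -
  have p: "p \<in> letters" by (cases p) auto
  have "(\<lambda>v. H v * (\<Prod>p\<in>letters - {p}. letter_theta \<tau> p v ^ M p)) \<in>
    theta_space \<tau> (M p * 4 + (\<Sum>p\<in>letters - {p}. M p * 4))"
    by (intro theta_space_mult H theta_space_prod theta_space_power letter_theta_in_theta_space[OF tau]) auto
  moreover have "M p * 4 + (\<Sum>p\<in>letters - {p}. M p * 4) = (\<Sum>p\<in>letters. M p * 4)"
    using p by (subst sum.remove[of letters p]) auto
  moreover have "theta_weight \<tau> M v = letter_theta \<tau> p v ^ M p * (\<Prod>p\<in>letters - {p}. letter_theta \<tau> p v ^ M p)" for v
    unfolding theta_weight_def using p by (subst prod.remove[of letters p]) auto
  ultimately show ?thesis unfolding theta_quotient_def using h by (metis (no_types, lifting) mult.assoc)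
qed

lemma theta_quotient_jacobi_power:
  assumes "a \<le> M p" and G: "\<And>u. u \<in> G \<Longrightarrow> letter_theta \<tau> p (jarg \<tau> u) \<noteq> 0"
  shows "theta_quotient \<tau> M G (\<lambda>u. jacobi \<tau> q p u ^ a)"
proof (rule theta_quotient_single)
  let ?c = "jcoeff \<tau> q / jcoeff \<tau> p"
  let ?H = "\<lambda>v. ?c ^ a * (letter_theta \<tau> q v ^ a * letter_theta \<tau> p v ^ (M p - a))"
  have "?H \<in> theta_space \<tau> (a * 4 + (M p - a) * 4)"
    by (intro theta_space_cmult theta_space_mult theta_space_power letter_theta_in_theta_space[OF tau])
  also have "a * 4 + (M p - a) * 4 = M p * 4" using assms(1) by simp
  finally show "?H \<in> theta_space \<tau> (M p * 4)" .
  fix u assume "u \<in> G"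
  have "letter_theta \<tau> p (jarg \<tau> u) ^ M p = letter_theta \<tau> p (jarg \<tau> u) ^ a * letter_theta \<tau> p (jarg \<tau> u) ^ (M p - a)"
    using assms(1) by (simp flip: power_add)
  thus "jacobi \<tau> q p u ^ a * letter_theta \<tau> p (jarg \<tau> u) ^ M p = ?H (jarg \<tau> u)"
    using G[OF \<open>u \<in> G\<close>] unfolding jacobi_eq[OF tau G[OF \<open>u \<in> G\<close>]]
    by (simp add: power_mult_distrib power_divide)
qed

text \<open>A \<open>b\<close>-th derivative has the power \<open>b + 1\<close> in its denominator,
  the origin of the summand 4 added to four times a derivative order in the pole count.\<close>

lemma theta_quotient_jacobi_deriv:
  assumes "b + 1 \<le> M p" and G: "\<And>u. u \<in> G \<Longrightarrow> letter_theta \<tau> p (jarg \<tau> u) \<noteq> 0"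
  shows "theta_quotient \<tau> M G ((deriv ^^ b) (jacobi \<tau> q p))"
proof -
  obtain H where H: "H \<in> theta_space \<tau> (4 * (b + 1))"
    "\<And>u. letter_theta \<tau> p (jarg \<tau> u) \<noteq> 0 \<Longrightarrow>
      (deriv ^^ b) (jacobi \<tau> q p) u = H (jarg \<tau> u) / letter_theta \<tau> p (jarg \<tau> u) ^ (b + 1)"
    using jacobi_higher_deriv[OF tau] by blast
  show ?thesis
  proof (rule theta_quotient_single)
    let ?H = "\<lambda>v. H v * letter_theta \<tau> p v ^ (M p - (b + 1))"
    have "?H \<in> theta_space \<tau> (4 * (b + 1) + (M p - (b + 1)) * 4)"
      by (intro H theta_space_mult theta_space_power letter_theta_in_theta_space[OF tau])
    also have "4 * (b + 1) + (M p - (b + 1)) * 4 = M p * 4" using assms(1) by simp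
    finally show "?H \<in> theta_space \<tau> (M p * 4)" .
    fix u assume "u \<in> G"
    have "letter_theta \<tau> p (jarg \<tau> u) ^ M p = letter_theta \<tau> p (jarg \<tau> u) ^ (b + 1) * letter_theta \<tau> p (jarg \<tau> u) ^ (M p - (b + 1))"
      unfolding power_add[symmetric] using assms(1) by simp
    thus "(deriv ^^ b) (jacobi \<tau> q p) u * letter_theta \<tau> p (jarg \<tau> u) ^ M p = ?H (jarg \<tau> u)"
      using G[OF \<open>u \<in> G\<close>] unfolding H(2)[OF G[OF \<open>u \<in> G\<close>]] by simp
  qed
qed

end

lemma det_mult_rows:
  fixes w :: "nat \<Rightarrow> 'a :: comm_ring_1"
  shows "Determinant.det (Matrix.mat n n (\<lambda>(i, j). w i * h i j)) = (\<Prod>i<n. w i) * Determinant.det (Matrix.mat n n (\<lambda>(i, j). h i j))"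
proof -
  have "Determinant.det (Matrix.mat n n (\<lambda>(i, j). w i * h i j)) =
    (\<Sum>p | p permutes {0..<n}. signof p * (\<Prod>i=0..<n. w i * h i (p i)))"
    using permutes_in_image by (subst det_def') (fastforce intro!: sum.cong prod.cong)+
  also have "\<dots> = (\<Prod>i<n. w i) * (\<Sum>p | p permutes {0..<n}. signof p * (\<Prod>i=0..<n. h i (p i)))"
    by (simp add: prod.distrib sum_distrib_left mult_ac lessThan_atLeast0)
  also have "(\<Sum>p | p permutes {0..<n}. signof p * (\<Prod>i=0..<n. h i (p i))) = Determinant.det (Matrix.mat n n (\<lambda>(i, j). h i j))"
    using permutes_in_image by (subst det_def') (fastforce intro!: sum.cong prod.cong)+
  finally show ?thesis .
qed

text \<open>Multiplying row \<open>i\<close> by the weight at \<open>u i\<close> turns all columns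
  into theta functions whose degree is the size of the matrix. Linearity of
  \<open>jarg \<tau>\<close> keeps the sum of the arguments 0, and the nonzero weights are divided
  out again.\<close>

lemma det_theta_quotients_eq_0:
  assumes "Im \<tau> > 0" and n: "n = (\<Sum>p\<in>letters. M p * 4)" "n > 0"
    and h: "\<And>j. j < n \<Longrightarrow> theta_quotient \<tau> M G (h j)"
    and u: "\<And>i. i < n \<Longrightarrow> u i \<in> G" "(\<Sum>i<n. u i) = 0"
    and G: "\<And>x. x \<in> G \<Longrightarrow> theta_weight \<tau> M (jarg \<tau> x) \<noteq> 0"
  shows "Determinant.det (Matrix.mat n n (\<lambda>(i, j). h j (u i))) = 0"
proof -
  have "\<exists>H. \<forall>j. j < n \<longrightarrow> H j \<in> theta_space \<tau> n \<and>
    (\<forall>x\<in>G. h j x * theta_weight \<tau> M (jarg \<tau> x) = H j (jarg \<tau> x))"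
    using h unfolding theta_quotient_def n(1)[symmetric] by (intro choice) blast
  then obtain H where H: "\<And>j. j < n \<Longrightarrow> H j \<in> theta_space \<tau> n"
    "\<And>j x. j < n \<Longrightarrow> x \<in> G \<Longrightarrow> h j x * theta_weight \<tau> M (jarg \<tau> x) = H j (jarg \<tau> x)" by blast
  have "even n" unfolding n(1) by (rule dvd_sum) simp
  moreover have "(\<Sum>i<n. jarg \<tau> (u i)) = 0"
    using u(2) by (simp add: jarg_def flip: sum_divide_distrib sum_distrib_left)
  ultimately have "0 = Determinant.det (Matrix.mat n n (\<lambda>(i, j). H j (jarg \<tau> (u i))))"
    using H n by (intro det_theta_space_eq_0[symmetric]) auto
  also have "Matrix.mat n n (\<lambda>(i, j). H j (jarg \<tau> (u i))) =
    Matrix.mat n n (\<lambda>(i, j). theta_weight \<tau> M (jarg \<tau> (u i)) * h j (u i))"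
    using H(2) u(1) by (intro eq_matI) (auto simp: mult_ac)
  also have "Determinant.det \<dots> = (\<Prod>i<n. theta_weight \<tau> M (jarg \<tau> (u i))) * Determinant.det (Matrix.mat n n (\<lambda>(i, j). h j (u i)))"
    by (rule det_mult_rows)
  finally show ?thesis using G u(1) by auto
qed

section \<open>From the pole count to the vanishing determinant\<close>

theorem theorem2p1:
  fixes \<tau> :: complex
    and r :: nat
    and f :: "nat \<Rightarrow> complex \<Rightarrow> complex"
    and \<alpha> \<alpha>' :: "nat \<Rightarrow> nat list"
    and \<beta> \<beta>' :: "nat \<Rightarrow> int list"
    and N :: nat
    and \<mu> \<nu> :: "nat \<Rightarrow> nat \<Rightarrow> complex"
    and F :: "complex \<Rightarrow> complex"
    and g :: "(complex \<Rightarrow> complex) list"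
    and zs :: "complex list"
    and z :: complex
  assumes tau: "Im \<tau> > 0"
    and f_jacobi: "\<And>l. l < r \<Longrightarrow> f l \<in> jacobi_functions \<tau>"
    and f_distinct: "inj_on f {..<r}"
    and alpha_increasing: "\<And>l. l < r \<Longrightarrow> sorted_wrt (<) (\<alpha> l)"
    and alpha'_increasing: "\<And>l. l < r \<Longrightarrow> sorted_wrt (<) (\<alpha>' l)"
    and alpha_positive: "\<And>l a. l < r \<Longrightarrow> a \<in> set (\<alpha> l) \<union> set (\<alpha>' l) \<Longrightarrow> a > 0"
    and alpha_distinct: "\<And>l. l < r \<Longrightarrow> set (\<alpha> l) \<inter> set (\<alpha>' l) = {}"
    and beta_increasing: "\<And>l. l < r \<Longrightarrow> sorted_wrt (<) (\<beta> l)"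
    and beta'_increasing: "\<And>l. l < r \<Longrightarrow> sorted_wrt (<) (\<beta>' l)"
    and beta_range: "\<And>l b. l < r \<Longrightarrow> b \<in> set (\<beta> l) \<union> set (\<beta>' l) \<Longrightarrow> b > 0 \<or> b = -1"
    and N: "N = (\<Sum>l<r. length (\<alpha> l) + length (\<beta> l))"
    and pole_count:
      "(\<Sum>p\<in>{letter_s, letter_c, letter_d, letter_n}. Max_or_zero
          ({4 * int (last (\<alpha> l)) | l. l < r \<and> f l \<in> pole_class \<tau> p \<and> \<alpha> l \<noteq> []} \<union>
           {4 * int (last (\<alpha>' l)) | l. l < r \<and> f l \<in> pole_class \<tau> p \<and> \<alpha>' l \<noteq> []} \<union>
           {4 * last (\<beta> l) + 4 | l. l < r \<and> f l \<in> pole_class \<tau> p \<and> \<beta> l \<noteq> []} \<union>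
           {4 * last (\<beta>' l) + 4 | l. l < r \<and> f l \<in> pole_class \<tau> p \<and> \<beta>' l \<noteq> []}))
       = 1 + int N"
    and F: "F = (\<lambda>u.
          (\<Sum>l<r. \<Sum>j<length (\<alpha>' l). \<mu> l j * f l u ^ (\<alpha>' l ! j)) +
          (\<Sum>l<r. \<Sum>j<length (\<beta>' l). \<nu> l j * ext_deriv (\<beta>' l ! j) (f l) u))"
    and g: "g = concat (map (\<lambda>l. map (\<lambda>a u. f l u ^ a) (\<alpha> l) @ map (\<lambda>b. ext_deriv b (f l)) (\<beta> l))
                [0..<r])"
    and zs_length: "length zs = N"
    and z_sum: "z + sum_list zs = 0"
    and no_pole: "\<And>l x. l < r \<Longrightarrow> x \<in> set (zs @ [z]) \<Longrightarrow> \<not> is_pole (f l) x"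
  shows "Determinant.det
           (Matrix.mat (N + 1) (N + 1) (\<lambda>(i, j). ((F # g) ! j) ((zs @ [z]) ! i))) = 0"
proof -
  define A where "A = (\<lambda>p.
    {4 * int (last (\<alpha> l)) | l. l < r \<and> f l \<in> pole_class \<tau> p \<and> \<alpha> l \<noteq> []} \<union>
    {4 * int (last (\<alpha>' l)) | l. l < r \<and> f l \<in> pole_class \<tau> p \<and> \<alpha>' l \<noteq> []} \<union>
    {4 * last (\<beta> l) + 4 | l. l < r \<and> f l \<in> pole_class \<tau> p \<and> \<beta> l \<noteq> []} \<union>
    {4 * last (\<beta>' l) + 4 | l. l < r \<and> f l \<in> pole_class \<tau> p \<and> \<beta>' l \<noteq> []})"
  define M where "M = (\<lambda>p. nat (Max_or_zero (A p)) div 4)"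
  define G where "G = {u. \<forall>l p. l < r \<longrightarrow> f l \<in> pole_class \<tau> p \<longrightarrow> letter_theta \<tau> p (jarg \<tau> u) \<noteq> 0}"
  have finA: "finite (A p)" for p unfolding A_def by simp
  \<comment> \<open>The order -1 contributes \<open>4 * (-1) + 4 = 0\<close>, so all members of
    \<open>A p\<close> are nonnegative.\<close>
  have beta_last: "last (\<beta> l) \<ge> -1" if "l < r" "\<beta> l \<noteq> []" for l
    using beta_range[OF that(1), of "last (\<beta> l)"] that(2) by auto
  have beta'_last: "last (\<beta>' l) \<ge> -1" if "l < r" "\<beta>' l \<noteq> []" for l
    using beta_range[OF that(1), of "last (\<beta>' l)"] that(2) by auto
  have A_mult: "4 dvd x \<and> x \<ge> 0" if "x \<in> A p" for x p
    using that beta_last beta'_last unfolding A_def by fastforce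
  have M: "Max_or_zero (A p) = 4 * int (M p)" for p
    unfolding M_def by (rule Max_or_zero_multiple[OF finA A_mult])
  have A_le: "x \<le> 4 * int (M p)" if "x \<in> A p" for x p
    using Max_or_zero_multiple(2)[OF finA A_mult that] by (simp add: M)
  \<comment> \<open>The hypothesis on the maxima says that the size of the matrix equals the degree
    of the weight.\<close>
  have N1: "N + 1 = (\<Sum>p\<in>letters. M p * 4)"
  proof -
    have "(\<Sum>p\<in>letters. Max_or_zero (A p)) = 1 + int N"
      unfolding A_def by (rule pole_count)
    hence "(\<Sum>p\<in>letters. 4 * int (M p)) = 1 + int N" by (simp only: M)
    thus ?thesis by simp
  qed
  have alpha_le: "a \<le> M p" if "l < r" "f l \<in> pole_class \<tau> p" "a \<in> set (\<alpha> l) \<union> set (\<alpha>' l)" for l p a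
  proof -
    have "4 * int a \<le> 4 * int (M p)"
    proof (cases "a \<in> set (\<alpha> l)")
      case True
      hence "a \<le> last (\<alpha> l)" using le_last_if_sorted[OF alpha_increasing[OF that(1)]] by blast
      moreover have "4 * int (last (\<alpha> l)) \<in> A p" using that True unfolding A_def by force
      ultimately show ?thesis using A_le by fastforce
    next
      case False
      hence "a \<in> set (\<alpha>' l)" using that by blast
      hence "a \<le> last (\<alpha>' l)" using le_last_if_sorted[OF alpha'_increasing[OF that(1)]] by blast
      moreover have "4 * int (last (\<alpha>' l)) \<in> A p" using that \<open>a \<in> set (\<alpha>' l)\<close> unfolding A_def by force
      ultimately show ?thesis using A_le by fastforce
    qed
    thus ?thesis by simp
  qed
  have beta_le: "nat b + 1 \<le> M p" if "l < r" "f l \<in> pole_class \<tau> p" "b \<in> set (\<beta> l) \<union> set (\<beta>' l)" "b > 0" for l p b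
  proof -
    have "4 * b + 4 \<le> 4 * int (M p)"
    proof (cases "b \<in> set (\<beta> l)")
      case True
      hence "b \<le> last (\<beta> l)" using le_last_if_sorted[OF beta_increasing[OF that(1)]] by blast
      moreover have "4 * last (\<beta> l) + 4 \<in> A p" using that True unfolding A_def by force
      ultimately show ?thesis using A_le by fastforce
    next
      case False
      hence "b \<in> set (\<beta>' l)" using that by blast
      hence "b \<le> last (\<beta>' l)" using le_last_if_sorted[OF beta'_increasing[OF that(1)]] by blast
      moreover have "4 * last (\<beta>' l) + 4 \<in> A p" using that \<open>b \<in> set (\<beta>' l)\<close> unfolding A_def by force
      ultimately show ?thesis using A_le by fastforce
    qed
    thus ?thesis using that(4) by simp
  qed
  have f_cases: "\<exists>p q. f l = jacobi \<tau> q p \<and> f l \<in> pole_class \<tau> p" if "l < r" for l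
    using f_jacobi[OF that] unfolding jacobi_functions_def pole_class_def by blast
  have power: "theta_quotient \<tau> M G (\<lambda>u. f l u ^ a)" if l: "l < r" and a: "a \<in> set (\<alpha> l) \<union> set (\<alpha>' l)" for l a
  proof -
    obtain p q where pq: "f l = jacobi \<tau> q p" "f l \<in> pole_class \<tau> p" using f_cases[OF l] by blast
    show ?thesis unfolding pq(1)
      by (rule theta_quotient_jacobi_power[where M = M and p = p, OF tau alpha_le[OF l pq(2) a]]) (use l pq(2) in \<open>auto simp: G_def\<close>)
  qed
  have deriv: "theta_quotient \<tau> M G (ext_deriv b (f l))" if l: "l < r" and b: "b \<in> set (\<beta> l) \<union> set (\<beta>' l)" for l b
  proof (cases "b = -1")
    case True
    thus ?thesis using theta_quotient_const[OF tau] by (simp add: ext_deriv_def)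
  next
    case False
    hence "b > 0" using beta_range[OF l b] by blast
    obtain p q where pq: "f l = jacobi \<tau> q p" "f l \<in> pole_class \<tau> p" using f_cases[OF l] by blast
    have eq: "ext_deriv b (f l) = (deriv ^^ nat b) (jacobi \<tau> q p)"
      using False pq(1) by (simp add: ext_deriv_def)
    show ?thesis unfolding eq
      by (rule theta_quotient_jacobi_deriv[where M = M and p = p, OF tau beta_le[OF l pq(2) b \<open>b > 0\<close>]]) (use l pq(2) in \<open>auto simp: G_def\<close>)
  qed
  have "theta_quotient \<tau> M G F" unfolding F
    by (intro theta_quotient_add theta_quotient_sum theta_quotient_cmult power deriv) auto
  moreover have "theta_quotient \<tau> M G h" if "h \<in> set g" for h
    using that power deriv unfolding g by auto
  ultimately have cols: "theta_quotient \<tau> M G h" if "h \<in> set (F # g)" for h using that by auto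
  have "length g = N"
    unfolding g N by (simp add: length_concat o_def interv_sum_list_conv_sum_set_nat lessThan_atLeast0)
  show ?thesis
  proof (rule det_theta_quotients_eq_0[OF tau N1])
    show "theta_quotient \<tau> M G ((F # g) ! j)" if "j < N + 1" for j
      using that \<open>length g = N\<close> by (intro cols nth_mem) simp
  next
    fix i assume i: "i < N + 1"
    show "(zs @ [z]) ! i \<in> G"
    \<comment> \<open>A zero of the theta function for a letter would be a pole of every
      \<open>f l\<close> in the pole class of that letter.\<close>
    proof (unfold G_def, safe)
      fix l p assume l: "l < r" "f l \<in> pole_class \<tau> p" and zero: "letter_theta \<tau> p (jarg \<tau> ((zs @ [z]) ! i)) = 0"
      obtain q where "f l = jacobi \<tau> q p" "q \<noteq> p" using l(2) by (auto simp: pole_class_def)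
      hence "is_pole (f l) ((zs @ [z]) ! i)" using jacobi_is_pole[OF tau _ zero] by simp
      moreover have "(zs @ [z]) ! i \<in> set (zs @ [z])" using i zs_length by (intro nth_mem) simp
      ultimately show False using no_pole[OF l(1)] by blast
    qed
  next
    have "(\<Sum>i<N + 1. (zs @ [z]) ! i) = sum_list (zs @ [z])"
      using zs_length by (simp add: sum_list_sum_nth lessThan_atLeast0 del: sum.op_ivl_Suc)
    thus "(\<Sum>i<N + 1. (zs @ [z]) ! i) = 0" using z_sum by (simp add: add.commute)
  next
    fix x assume x: "x \<in> G"
    show "theta_weight \<tau> M (jarg \<tau> x) \<noteq> 0"
    proof
      assume "theta_weight \<tau> M (jarg \<tau> x) = 0"
      then obtain p where p: "letter_theta \<tau> p (jarg \<tau> x) = 0" "M p \<noteq> 0"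
        unfolding theta_weight_def by (auto simp del: letter_theta.simps)
      \<comment> \<open>A letter with positive exponent has some \<open>f l\<close> in its pole
        class, and points of \<open>G\<close> avoid the zeros of its theta function.\<close>
      have "A p \<noteq> {}"
      proof
        assume "A p = {}"
        thus False using p(2) M[of p] by (simp add: Max_or_zero_def)
      qed
      then obtain l where "l < r" "f l \<in> pole_class \<tau> p" unfolding A_def by blast
      thus False using x p(1) by (auto simp: G_def)
    qed
  qed simp
qed

end
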